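(* Let $\delta\ge0$, $L_2>0$, and let $f:\mathbb R^d\to\mathbb R$ be convex with a minimizer $x^*$ and twice continuously differentiable with $\|\nabla^2f(x)-\nabla^2f(y)\|\le L_2\|x-y\|$ for all $x,y$. Let $H$ be a $\delta$-Hessian estimator: $H(x)=H(x)^\top$ and $\|H(x)-\nabla^2f(x)\|\le\delta$ for all $x\in\mathbb{R}^d$. Consider the AINE algorithm with $p=2$ (see context), in which the second-order oracle $\mathbb O_2^\delta$ is implemented by the inexact cubic regularized Newton step: on input $x$ it returns $$y\in\arg\min_{y\in\mathbb R^d}\ \langle\nabla f(x),y-x\rangle+\tfrac12\langle(H(x)+2\delta I_d)(y-x),y-x\rangle+\tfrac{L_2}{3}\|y-x\|^3,\qquad \lambda=2\delta+L_2\|y-x\|.$$ Then for every $\epsilon>0$ the algorithm finds an $\epsilon$-solution, i.e. a point $\hat x$ with $f(\hat x)-\min f\le\epsilon$, with inexact second-order oracle complexity (number of evaluations of $H$) $$O\left((\delta/\epsilon)^{1/2}+(L_2/\epsilon)^{2/7}\right).$$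
   Context: Norms: Euclidean norm for vectors, operator norm for matrices. AINE algorithm for $p=2$ (inputs $x_0,T,\delta,L_2$; $D_0=\frac12\|x_0-x^*\|^2$). Initialize $v_0=z_0=x_0$, $A_0=0$, $(y_0,\lambda_0)=\mathbb O_2^\delta(z_0)$. For $t=0,\dots,T-1$: - Guess $\lambda'_t$: if $t=0$, $\lambda'_0=\lambda_0$; else if $t=1$ or $A_t>2A_s$ (where $s$ is the currently stored index), set $s:=t$, store $A_s=A_t$, and choose $\lambda'_t=\lambda'_s=\Theta\big(\delta+(D_0L_2^2/A_s^{3/2})^{2/7}\big)$ (fixed constants in $\Theta$); otherwise $\lambda'_t=\lambda'_s$ for the stored $s$. - $a'_{t+1}=\big(1+\sqrt{1+4\lambda'_tA_t}\big)/(2\lambda'_t)$, $A'_{t+1}=A_t+a'_{t+1}$, $z_t=(A_tx_t+a'_{t+1}v_t)/A'_{t+1}$. - If $t>0$: $(y_t,\lambda_t)=\mathbb O_2^\delta(z_t)$. - $\beta_t=\min\{1,\lambda'_t/\lambda_t\}$ (equal to $1$ if $\lambda_t=0$), $a_{t+1}=\beta_ta'_{t+1}$, $A_{t+1}=A_t+a_{t+1}$. - $x_{t+1}=\big((1-\beta_t)A_tx_t+\beta_tA'_{t+1}y_t\big)/A_{t+1}$, $v_{t+1}=v_t-a_{t+1}\nabla f(y_t)$. Output $x_T$. (If $\lambda_0=0$, then $y_0$ is a minimizer and is returned.) Each oracle call uses one evaluation of $H$. The $O(\cdot)$ bound means: at most $C\max\{1,(\delta/\epsilon)^{1/2}+(L_2/\epsilon)^{2/7}\}$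 evaluations of $H$, where $C$ depends only on $D_0$ and on the constants in the $\Theta$. *)

theory Defs
  imports Complex_Main "Jordan_Normal_Form.Matrix"
begin

text \<open>
  The constant in the complexity bound is uniform in the dimension, so the dimension has to be
  quantified inside the formula. Points of d-dimensional Euclidean space are therefore the
  vectors in \<open>carrier_vec d\<close>; these carry no topology or norm in the library, and the
  Euclidean notions are spelled out below.
\<close>

definition vec_norm :: "real vec \<Rightarrow> real" where
  "vec_norm v = sqrt (v \<bullet> v)"

definition op_norm :: "real mat \<Rightarrow> real" where
  "op_norm M = (SUP v \<in> {v \<in> carrier_vec (dim_col M). vec_norm v \<le> 1}. vec_norm (M *\<^sub>v v))"

definition convex_fun :: "nat \<Rightarrow> (real vec \<Rightarrow> real) \<Rightarrow> bool" where
  "convex_fun d f \<longleftrightarrow>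
     (\<forall>x \<in> carrier_vec d. \<forall>y \<in> carrier_vec d. \<forall>u \<in> {0..1}.
        f ((1 - u) \<cdot>\<^sub>v x + u \<cdot>\<^sub>v y) \<le> (1 - u) * f x + u * f y)"

text \<open>Frechet derivatives: \<open>gf\<close> is the gradient of \<open>f\<close>, \<open>Hf\<close> the Jacobian of \<open>gf\<close>.\<close>

definition has_gradient :: "nat \<Rightarrow> (real vec \<Rightarrow> real) \<Rightarrow> (real vec \<Rightarrow> real vec) \<Rightarrow> bool" where
  "has_gradient d f gf \<longleftrightarrow>
     (\<forall>x \<in> carrier_vec d. gf x \<in> carrier_vec d \<and>
        (\<forall>e > 0. \<exists>r > 0. \<forall>h \<in> carrier_vec d. vec_norm h < r \<longrightarrow>
           \<bar>f (x + h) - f x - gf x \<bullet> h\<bar> \<le> e * vec_norm h))"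

definition has_jacobian :: "nat \<Rightarrow> (real vec \<Rightarrow> real vec) \<Rightarrow> (real vec \<Rightarrow> real mat) \<Rightarrow> bool" where
  "has_jacobian d gf Hf \<longleftrightarrow>
     (\<forall>x \<in> carrier_vec d. Hf x \<in> carrier_mat d d \<and>
        (\<forall>e > 0. \<exists>r > 0. \<forall>h \<in> carrier_vec d. vec_norm h < r \<longrightarrow>
           vec_norm (gf (x + h) - gf x - Hf x *\<^sub>v h) \<le> e * vec_norm h))"

definition mat_continuous :: "nat \<Rightarrow> (real vec \<Rightarrow> real mat) \<Rightarrow> bool" where
  "mat_continuous d F \<longleftrightarrow>
     (\<forall>x \<in> carrier_vec d. \<forall>e > 0. \<exists>r > 0. \<forall>y \<in> carrier_vec d.
        vec_norm (y - x) < r \<longrightarrow> op_norm (F y - F x) < e)"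

definition twice_cont_differentiable ::
    "nat \<Rightarrow> (real vec \<Rightarrow> real) \<Rightarrow> (real vec \<Rightarrow> real vec) \<Rightarrow> (real vec \<Rightarrow> real mat) \<Rightarrow> bool" where
  "twice_cont_differentiable d f gf Hf \<longleftrightarrow>
     has_gradient d f gf \<and> has_jacobian d gf Hf \<and> mat_continuous d Hf"

definition lipschitz_hessian :: "nat \<Rightarrow> real \<Rightarrow> (real vec \<Rightarrow> real mat) \<Rightarrow> bool" where
  "lipschitz_hessian d L2 Hf \<longleftrightarrow>
     (\<forall>x \<in> carrier_vec d. \<forall>y \<in> carrier_vec d. op_norm (Hf x - Hf y) \<le> L2 * vec_norm (x - y))"

definition hessian_estimator ::
    "nat \<Rightarrow> real \<Rightarrow> (real vec \<Rightarrow> real mat) \<Rightarrow> (real vec \<Rightarrow> real mat) \<Rightarrow> bool" where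
  "hessian_estimator d \<delta> Hf H \<longleftrightarrow>
     (\<forall>x \<in> carrier_vec d. H x \<in> carrier_mat d d \<and> H x = transpose_mat (H x) \<and>
        op_norm (H x - Hf x) \<le> \<delta>)"

definition cubic_model ::
    "nat \<Rightarrow> (real vec \<Rightarrow> real vec) \<Rightarrow> (real vec \<Rightarrow> real mat) \<Rightarrow> real \<Rightarrow> real \<Rightarrow>
     real vec \<Rightarrow> real vec \<Rightarrow> real" where
  "cubic_model d gf H \<delta> L2 x y =
     gf x \<bullet> (y - x)
     + 1/2 * (((H x + (2 * \<delta>) \<cdot>\<^sub>m 1\<^sub>m d) *\<^sub>v (y - x)) \<bullet> (y - x))
     + L2 / 3 * vec_norm (y - x) ^ 3"

text \<open>
  The oracle is a relation between the query \<open>x\<close> and the answer \<open>(y, lam)\<close>: any minimizer of the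
  cubic model may be returned.
\<close>

definition cubic_newton_oracle ::
    "nat \<Rightarrow> (real vec \<Rightarrow> real vec) \<Rightarrow> (real vec \<Rightarrow> real mat) \<Rightarrow> real \<Rightarrow> real \<Rightarrow>
     real vec \<Rightarrow> real vec \<Rightarrow> real \<Rightarrow> bool" where
  "cubic_newton_oracle d gf H \<delta> L2 x y lam \<longleftrightarrow>
     is_arg_min (cubic_model d gf H \<delta> L2 x) (\<lambda>y. y \<in> carrier_vec d) y \<and>
     lam = 2 * \<delta> + L2 * vec_norm (y - x)"

definition guess_scale :: "real \<Rightarrow> real \<Rightarrow> real \<Rightarrow> real \<Rightarrow> real" where
  "guess_scale D0 \<delta> L2 A = \<delta> + (D0 * L2\<^sup>2 / A powr (3/2)) powr (2/7)"

text \<open>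
  A run of AINE with \<open>T\<close> iterations, as the sequences of values taken by its variables.
  The constants hidden in the \<open>\<Theta>\<close> of the guess are \<open>c1\<close> and \<open>c2\<close>: a fresh guess is any value between
  \<open>c1\<close> and \<open>c2\<close> times its scale. \<open>s t\<close> is the index stored after the guess of iteration \<open>t\<close>
  (\<open>s 0\<close> is irrelevant), and \<open>calls t\<close> is the number of oracle calls (evaluations of \<open>H\<close>) made
  before iteration \<open>t\<close>; iteration 0 reuses the call of the initialization.
  When \<open>lam 0 = 0\<close> the loop is not entered.
\<close>

locale aine_run =
  fixes d :: nat
    and gf :: "real vec \<Rightarrow> real vec" and H :: "real vec \<Rightarrow> real mat"
    and \<delta> L2 D0 c1 c2 :: real
    and x0 :: "real vec" and T :: nat
    and x v z y :: "nat \<Rightarrow> real vec"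
    and a a' A A' lam lam' \<beta> :: "nat \<Rightarrow> real"
    and s calls :: "nat \<Rightarrow> nat"
  assumes init: "x 0 = x0" "v 0 = x0" "z 0 = x0" "A 0 = 0"
    and init_oracle: "cubic_newton_oracle d gf H \<delta> L2 (z 0) (y 0) (lam 0)"
    and init_calls: "calls 0 = 1"
    and guess_first: "lam 0 \<noteq> 0 \<Longrightarrow> 0 < T \<Longrightarrow> lam' 0 = lam 0"
    and guess_fresh:
      "\<And>t. lam 0 \<noteq> 0 \<Longrightarrow> 0 < t \<Longrightarrow> t < T \<Longrightarrow> t = 1 \<or> A t > 2 * A (s (t - 1)) \<Longrightarrow>
         s t = t \<and> lam' t \<in> {c1 * guess_scale D0 \<delta> L2 (A t) .. c2 * guess_scale D0 \<delta> L2 (A t)}"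
    and guess_stored:
      "\<And>t. lam 0 \<noteq> 0 \<Longrightarrow> 0 < t \<Longrightarrow> t < T \<Longrightarrow> \<not> (t = 1 \<or> A t > 2 * A (s (t - 1))) \<Longrightarrow>
         s t = s (t - 1) \<and> lam' t = lam' (s t)"
    and extrapolate:
      "\<And>t. lam 0 \<noteq> 0 \<Longrightarrow> t < T \<Longrightarrow>
         a' (Suc t) = (1 + sqrt (1 + 4 * lam' t * A t)) / (2 * lam' t) \<and>
         A' (Suc t) = A t + a' (Suc t) \<and>
         z t = (1 / A' (Suc t)) \<cdot>\<^sub>v (A t \<cdot>\<^sub>v x t + a' (Suc t) \<cdot>\<^sub>v v t)"
    and loop_oracle:
      "\<And>t. lam 0 \<noteq> 0 \<Longrightarrow> 0 < t \<Longrightarrow> t < T \<Longrightarrow> cubic_newton_oracle d gf H \<delta> L2 (z t) (y t) (lam t)"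
    and count:
      "\<And>t. lam 0 \<noteq> 0 \<Longrightarrow> t < T \<Longrightarrow> calls (Suc t) = calls t + (if t > 0 then 1 else 0)"
    and damp:
      "\<And>t. lam 0 \<noteq> 0 \<Longrightarrow> t < T \<Longrightarrow>
         \<beta> t = (if lam t = 0 then 1 else min 1 (lam' t / lam t)) \<and>
         a (Suc t) = \<beta> t * a' (Suc t) \<and>
         A (Suc t) = A t + a (Suc t)"
    and update:
      "\<And>t. lam 0 \<noteq> 0 \<Longrightarrow> t < T \<Longrightarrow>
         x (Suc t) = (1 / A (Suc t)) \<cdot>\<^sub>v
            (((1 - \<beta> t) * A t) \<cdot>\<^sub>v x t + (\<beta> t * A' (Suc t)) \<cdot>\<^sub>v y t) \<and>
         v (Suc t) = v t - a (Suc t) \<cdot>\<^sub>v gf (y t)"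

definition aine_output ::
    "nat \<Rightarrow> (real vec \<Rightarrow> real vec) \<Rightarrow> (real vec \<Rightarrow> real mat) \<Rightarrow> real \<Rightarrow> real \<Rightarrow> real \<Rightarrow> real \<Rightarrow> real \<Rightarrow>
     real vec \<Rightarrow> nat \<Rightarrow> real vec \<Rightarrow> nat \<Rightarrow> bool" where
  "aine_output d gf H \<delta> L2 D0 c1 c2 x0 T xhat N \<longleftrightarrow>
     (\<exists>x v z y a a' A A' lam lam' \<beta> s calls.
        aine_run d gf H \<delta> L2 D0 c1 c2 x0 T x v z y a a' A A' lam lam' \<beta> s calls \<and>
        (if lam 0 = 0 then xhat = y 0 \<and> N = calls 0 else xhat = x T \<and> N = calls T))"

end

theory Submission
  imports Defs
begin

text \<open>
  Stationarity of the cubic model and the Lipschitz Hessian give the Monteiro-Svaiter condition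
  \<open>|\<nabla>f(y) + \<lambda> (y - z)| \<le> \<lambda> |y - z| / 2\<close> for every oracle answer. By the usual estimate sequence argument
  the potential \<open>A (f(x) - f*) + |v - x*|\<^sup>2/2\<close> then decreases by \<open>3/8 \<beta> A' \<lambda> |y - z|\<^sup>2\<close> per iteration,
  so it suffices that \<open>A\<close> reaches \<open>D0 / \<epsilon>\<close>.

  The guess \<open>\<lambda>'\<close> stays within constant factors of its scale \<open>S(A)\<close> at the current \<open>A\<close>. Put
  \<open>G(A) = (\<delta> A)^(1/2) + (D0 L2\<^sup>2)^(1/7) A^(2/7)\<close>; then \<open>A S(A) \<le> G(A)\<^sup>2\<close> and
  \<open>A S(A)\<^sup>3 \<ge> D0 L2\<^sup>2 / G(A)\<close>. If \<open>\<lambda>\<close> is at most a constant times \<open>\<lambda>'\<close>, the first inequality shows that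
  \<open>A\<close> grows by a factor \<open>1 + const / G(A)\<close>, hence \<open>G(A)\<close> by an additive constant. Otherwise the step is
  long, and the second one shows that the potential drops by \<open>const D0 / G(A)\<close>. As the potential
  starts at \<open>D0\<close>, both cases together occur \<open>O(G(D0 / \<epsilon>))\<close> times before \<open>A\<close> reaches \<open>D0 / \<epsilon>\<close>. No logarithm
  is lost at the start because \<open>G\<close> is bounded below already after the first iteration.
\<close>

section \<open>Euclidean vectors and Taylor expansion of the gradient\<close>

lemma scalar_prod_add_left:
  fixes u v w :: "real vec"
  shows "dim_vec u = dim_vec w \<Longrightarrow> dim_vec v = dim_vec w \<Longrightarrow> (u + v) \<bullet> w = u \<bullet> w + v \<bullet> w"
  by (rule add_scalar_prod_distrib[where n = "dim_vec w"]; rule carrier_vecI; simp)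

lemma scalar_prod_add_right:
  fixes u v w :: "real vec"
  shows "dim_vec u = dim_vec w \<Longrightarrow> dim_vec v = dim_vec w \<Longrightarrow> w \<bullet> (u + v) = w \<bullet> u + w \<bullet> v"
  by (rule scalar_prod_add_distrib[where n = "dim_vec w"]; rule carrier_vecI; simp)

lemma scalar_prod_diff_left:
  fixes u v w :: "real vec"
  shows "dim_vec u = dim_vec w \<Longrightarrow> dim_vec v = dim_vec w \<Longrightarrow> (u - v) \<bullet> w = u \<bullet> w - v \<bullet> w"
  by (rule minus_scalar_prod_distrib[where n = "dim_vec w"]; rule carrier_vecI; simp)

lemma scalar_prod_diff_right:
  fixes u v w :: "real vec"
  shows "dim_vec u = dim_vec w \<Longrightarrow> dim_vec v = dim_vec w \<Longrightarrow> w \<bullet> (u - v) = w \<bullet> u - w \<bullet> v"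
  by (rule scalar_prod_minus_distrib[where n = "dim_vec w"]; rule carrier_vecI; simp)

lemma scalar_prod_commute:
  fixes u v :: "real vec"
  shows "dim_vec u = dim_vec v \<Longrightarrow> u \<bullet> v = v \<bullet> u"
  by (rule comm_scalar_prod[where n = "dim_vec v"]; rule carrier_vecI; simp)

lemmas scalar_prod_bilinear =
  scalar_prod_add_left scalar_prod_add_right scalar_prod_diff_left scalar_prod_diff_right

lemma scalar_prod_self_nonneg: "0 \<le> (v :: real vec) \<bullet> v"
  by (auto simp: scalar_prod_def intro: sum_nonneg)

lemma vec_norm_nonneg: "0 \<le> vec_norm v"
  by (simp add: vec_norm_def scalar_prod_self_nonneg)

lemma vec_norm_sq: "(vec_norm v)\<^sup>2 = v \<bullet> v"
  by (simp add: vec_norm_def scalar_prod_self_nonneg)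

lemma vec_norm_smult: "vec_norm (c \<cdot>\<^sub>v v) = \<bar>c\<bar> * vec_norm v"
proof -
  have "(c \<cdot>\<^sub>v v) \<bullet> (c \<cdot>\<^sub>v v) = c\<^sup>2 * (v \<bullet> v)"
    by (simp add: power2_eq_square)
  then show ?thesis by (simp add: vec_norm_def real_sqrt_mult)
qed

lemma vec_norm_uminus: "vec_norm (- v) = vec_norm v"
  by (simp add: vec_norm_def)

text \<open>Nonnegativity of \<open>|c u - b v|\<^sup>2\<close> at \<open>c = q\<close>,
  \<open>b = r\<close> gives \<open>q * (p * q - r\<^sup>2) \<ge> 0\<close>; the degenerate case
  \<open>q = 0\<close> needs another choice.\<close>

lemma Cauchy_Schwarz_vec:
  fixes u v :: "real vec"
  assumes "dim_vec u = dim_vec v"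
  shows "\<bar>u \<bullet> v\<bar> \<le> vec_norm u * vec_norm v"
proof -
  define p q r where "p = u \<bullet> u" and "q = v \<bullet> v" and "r = u \<bullet> v"
  have comm: "v \<bullet> u = r" using assms by (simp add: r_def scalar_prod_commute)
  have "(c \<cdot>\<^sub>v u - b \<cdot>\<^sub>v v) \<bullet> (c \<cdot>\<^sub>v u - b \<cdot>\<^sub>v v) = c\<^sup>2 * p - 2 * b * c * r + b\<^sup>2 * q" for b c
    using assms
    by (simp add: scalar_prod_bilinear comm flip: p_def q_def r_def)
       (simp add: algebra_simps power2_eq_square)
  then have gram: "0 \<le> c\<^sup>2 * p - 2 * b * c * r + b\<^sup>2 * q" for b c
    by (metis scalar_prod_self_nonneg)
  have pq: "0 \<le> p" "0 \<le> q" by (simp_all add: p_def q_def scalar_prod_self_nonneg)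
  have "r\<^sup>2 \<le> p * q"
  proof (cases "q = 0")
    case True
    have "r = 0"
    proof (rule ccontr)
      assume "r \<noteq> 0"
      \<comment> \<open>With \<open>c = 1\<close> and this \<open>b\<close> the form equals
        \<open>p - (p + 1) = -1\<close>.\<close>
      with gram[of 1 "(p + 1) / (2 * r)"] True show False by simp
    qed
    then show ?thesis using pq by simp
  next
    case False
    have "0 \<le> q * (p * q - r\<^sup>2)"
      using gram[of q r] by (simp add: algebra_simps power2_eq_square)
    then show ?thesis using False pq by (simp add: zero_le_mult_iff)
  qed
  then have "r\<^sup>2 \<le> (vec_norm u * vec_norm v)\<^sup>2"
    by (simp add: power_mult_distrib vec_norm_sq p_def q_def)
  then show ?thesis
    unfolding r_def by (metis abs_le_square_iff abs_of_nonneg mult_nonneg_nonneg vec_norm_nonneg)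
qed

lemma vec_norm_triangle:
  assumes "dim_vec u = dim_vec v"
  shows "vec_norm (u + v) \<le> vec_norm u + vec_norm v"
proof (rule power2_le_imp_le)
  have "(vec_norm (u + v))\<^sup>2 = (vec_norm u)\<^sup>2 + 2 * (u \<bullet> v) + (vec_norm v)\<^sup>2"
    using assms by (simp add: vec_norm_sq scalar_prod_bilinear scalar_prod_commute)
  also have "\<dots> \<le> (vec_norm u + vec_norm v)\<^sup>2"
    using Cauchy_Schwarz_vec[OF assms] by (simp add: power2_sum abs_le_iff)
  finally show "(vec_norm (u + v))\<^sup>2 \<le> (vec_norm u + vec_norm v)\<^sup>2" .
qed (simp add: vec_norm_nonneg)

lemma scalar_prod_eq_0_if_vec_norm_le_0:
  assumes "vec_norm v \<le> 0" and "dim_vec u = dim_vec v"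
  shows "u \<bullet> v = 0"
  using Cauchy_Schwarz_vec[OF assms(2)] assms(1) vec_norm_nonneg[of v] by simp

text \<open>\<open>op_norm\<close> is a supremum, so it dominates its members only once they are
  known to be bounded. The Frobenius norm \<open>B\<close> bounds them by Cauchy-Schwarz on each
  row; scaling \<open>v\<close> to length one then gives the claim.\<close>

lemma vec_norm_mult_mat_vec_le:
  assumes M: "M \<in> carrier_mat n m" and v: "v \<in> carrier_vec m"
  shows "vec_norm (M *\<^sub>v v) \<le> op_norm M * vec_norm v"
proof -
  define B where "B = sqrt (\<Sum>i<n. (vec_norm (row M i))\<^sup>2)"
  have B: "vec_norm (M *\<^sub>v w) \<le> B * vec_norm w" if w: "w \<in> carrier_vec m" for w
  proof (rule power2_le_imp_le)
    have "(vec_norm (M *\<^sub>v w))\<^sup>2 = (\<Sum>i<n. (row M i \<bullet> w)\<^sup>2)"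
      using M by (simp add: vec_norm_sq scalar_prod_def[of "M *\<^sub>v w"] atLeast0LessThan flip: power2_eq_square)
    also have "\<dots> \<le> (\<Sum>i<n. (vec_norm (row M i))\<^sup>2 * (vec_norm w)\<^sup>2)"
    proof (rule sum_mono)
      fix i
      have "\<bar>row M i \<bullet> w\<bar> \<le> vec_norm (row M i) * vec_norm w"
        using M w by (intro Cauchy_Schwarz_vec) auto
      then show "(row M i \<bullet> w)\<^sup>2 \<le> (vec_norm (row M i))\<^sup>2 * (vec_norm w)\<^sup>2"
        by (metis abs_ge_zero power2_abs power_mono power_mult_distrib)
    qed
    also have "\<dots> = (B * vec_norm w)\<^sup>2"
      by (simp add: B_def power_mult_distrib sum_distrib_right sum_nonneg)
    finally show "(vec_norm (M *\<^sub>v w))\<^sup>2 \<le> (B * vec_norm w)\<^sup>2" .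
  qed (simp add: B_def sum_nonneg vec_norm_nonneg)
  have "0 \<le> B" by (simp add: B_def sum_nonneg)
  have bdd: "bdd_above ((\<lambda>v. vec_norm (M *\<^sub>v v)) ` {v \<in> carrier_vec m. vec_norm v \<le> 1})"
  proof (rule bdd_aboveI2)
    fix w assume w: "w \<in> {v \<in> carrier_vec m. vec_norm v \<le> 1}"
    then have "B * vec_norm w \<le> B * 1"
      using \<open>0 \<le> B\<close> by (intro mult_left_mono) auto
    with B[of w] w show "vec_norm (M *\<^sub>v w) \<le> B" by simp
  qed
  show ?thesis
  proof (cases "vec_norm v = 0")
    case True
    then show ?thesis using B[OF v] by simp
  next
    case False
    then have pos: "0 < vec_norm v" using vec_norm_nonneg[of v] by simp
    let ?w = "(1 / vec_norm v) \<cdot>\<^sub>v v"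
    have "?w \<in> {v \<in> carrier_vec m. vec_norm v \<le> 1}"
      using v pos by (simp add: vec_norm_smult)
    then have "vec_norm (M *\<^sub>v ?w) \<le> op_norm M"
      unfolding op_norm_def using M by (auto intro!: cSUP_upper bdd)
    moreover have "M *\<^sub>v ?w = (1 / vec_norm v) \<cdot>\<^sub>v (M *\<^sub>v v)"
      using M v by (rule mult_mat_vec)
    ultimately show ?thesis
      using pos by (simp add: vec_norm_smult field_simps)
  qed
qed

section \<open>First-order convexity and the second-order Taylor bound\<close>

lemma gradient_inequality:
  assumes "convex_fun d f" "has_gradient d f gf" and x: "x \<in> carrier_vec d" and y: "y \<in> carrier_vec d"
  shows "f y + gf y \<bullet> (x - y) \<le> f x"
proof (rule field_le_epsilon)
  fix e :: real assume "0 < e"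
  define n where "n = vec_norm (x - y)"
  have n: "0 \<le> n" by (simp add: n_def vec_norm_nonneg)
  \<comment> \<open>The \<open>+ 1\<close> covers \<open>x = y\<close>. The convexity inequality is
    finally divided by the small step \<open>u\<close>, which leaves an error of at most
    \<open>e\<close>.\<close>
  define e' where "e' = e / (n + 1)"
  have e': "0 < e'" "e' * n \<le> e"
    using \<open>0 < e\<close> n by (simp_all add: e'_def field_simps)
  have gc: "gf y \<in> carrier_vec d" using assms by (auto simp: has_gradient_def)
  obtain r where r: "0 < r" and grad: "\<And>h. h \<in> carrier_vec d \<Longrightarrow> vec_norm h < r \<Longrightarrow>
      \<bar>f (y + h) - f y - gf y \<bullet> h\<bar> \<le> e' * vec_norm h"
    using assms(2) y e'(1) unfolding has_gradient_def by meson
  define u where "u = min 1 (r / (2 * (n + 1)))"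
  have u: "0 < u" "u \<le> 1" "u * n < r"
  proof -
    show "0 < u" "u \<le> 1" using r n by (auto simp: u_def)
    have "u * n \<le> r / (2 * (n + 1)) * n" using n by (intro mult_right_mono) (auto simp: u_def)
    also have "\<dots> < r" using r n by (simp add: field_simps add_nonneg_pos)
    finally show "u * n < r" .
  qed
  have "y + u \<cdot>\<^sub>v (x - y) = (1 - u) \<cdot>\<^sub>v y + u \<cdot>\<^sub>v x"
    using x y by (intro eq_vecI) (auto simp: algebra_simps)
  then have "f (y + u \<cdot>\<^sub>v (x - y)) \<le> (1 - u) * f y + u * f x"
    using assms(1) x y u by (simp add: convex_fun_def)
  moreover have "\<bar>f (y + u \<cdot>\<^sub>v (x - y)) - f y - gf y \<bullet> (u \<cdot>\<^sub>v (x - y))\<bar> \<le> e' * vec_norm (u \<cdot>\<^sub>v (x - y))"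
    using x y u by (intro grad) (auto simp: vec_norm_smult n_def)
  moreover have "gf y \<bullet> (u \<cdot>\<^sub>v (x - y)) = u * (gf y \<bullet> (x - y))"
    using gc x y by simp
  ultimately have "u * (f y + gf y \<bullet> (x - y)) \<le> u * (f x + e' * n)"
    using u(1) by (simp add: vec_norm_smult n_def algebra_simps abs_le_iff)
  then show "f y + gf y \<bullet> (x - y) \<le> f x + e"
    using u(1) e'(2) by simp
qed

text \<open>Pairing with a fixed \<open>w\<close> makes the derivative along a line real-valued, so
  that \<open>gradient_taylor\<close> can argue by its sign.\<close>

lemma has_jacobian_DERIV:
  assumes J: "has_jacobian d g J" and z: "z \<in> carrier_vec d" and h: "h \<in> carrier_vec d"
    and w: "w \<in> carrier_vec d" and gc: "\<And>x. x \<in> carrier_vec d \<Longrightarrow> g x \<in> carrier_vec d"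
  shows "DERIV (\<lambda>t. w \<bullet> g (z + t \<cdot>\<^sub>v h)) t :> w \<bullet> (J (z + t \<cdot>\<^sub>v h) *\<^sub>v h)"
  unfolding DERIV_def LIM_eq
proof (intro allI impI)
  fix e :: real assume "0 < e"
  let ?p = "z + t \<cdot>\<^sub>v h"
  define n where "n = vec_norm w * vec_norm h"
  have n: "0 \<le> n" by (simp add: n_def vec_norm_nonneg)
  have p: "?p \<in> carrier_vec d" using z h by simp
  have Jp: "J ?p \<in> carrier_mat d d" using J p by (auto simp: has_jacobian_def)
  define e' where "e' = e / (n + 1)"
  have e': "0 < e'" "e' * n < e"
    using \<open>0 < e\<close> n by (simp_all add: e'_def field_simps)
  obtain r where r: "0 < r" and jac: "\<And>k. k \<in> carrier_vec d \<Longrightarrow> vec_norm k < r \<Longrightarrow>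
      vec_norm (g (?p + k) - g ?p - J ?p *\<^sub>v k) \<le> e' * vec_norm k"
    using J p e'(1) unfolding has_jacobian_def by meson
  define \<rho> where "\<rho> = r / (vec_norm h + 1)"
  have hn: "0 \<le> vec_norm h" by (rule vec_norm_nonneg)
  show "\<exists>s>0. \<forall>x. x \<noteq> 0 \<and> norm (x - 0) < s \<longrightarrow>
      norm ((w \<bullet> g (z + (t + x) \<cdot>\<^sub>v h) - w \<bullet> g ?p) / x - w \<bullet> (J ?p *\<^sub>v h)) < e"
  proof (intro exI[of _ \<rho>] conjI allI impI)
    show "0 < \<rho>" using r hn by (simp add: \<rho>_def)
    fix x :: real assume x: "x \<noteq> 0 \<and> norm (x - 0) < \<rho>"
    have "\<bar>x\<bar> * vec_norm h \<le> \<bar>x\<bar> * (vec_norm h + 1)" by (simp add: algebra_simps)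
    also have "\<dots> < r" using x hn by (simp add: \<rho>_def pos_less_divide_eq)
    finally have small: "vec_norm (x \<cdot>\<^sub>v h) < r" by (simp add: vec_norm_smult)
    have shift: "z + (t + x) \<cdot>\<^sub>v h = ?p + x \<cdot>\<^sub>v h"
      using z h by (intro eq_vecI) (auto simp: algebra_simps)
    let ?D = "g (?p + x \<cdot>\<^sub>v h) - g ?p - J ?p *\<^sub>v (x \<cdot>\<^sub>v h)"
    have c: "g (?p + x \<cdot>\<^sub>v h) \<in> carrier_vec d" "g ?p \<in> carrier_vec d" "J ?p *\<^sub>v h \<in> carrier_vec d"
      using z h p Jp by (auto intro!: gc)
    have "w \<bullet> ?D = w \<bullet> g (?p + x \<cdot>\<^sub>v h) - w \<bullet> g ?p - x * (w \<bullet> (J ?p *\<^sub>v h))"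
      using c[THEN carrier_vecD] w[THEN carrier_vecD]
      by (simp add: mult_mat_vec[OF Jp h] scalar_prod_bilinear)
    then have eq: "(w \<bullet> g (z + (t + x) \<cdot>\<^sub>v h) - w \<bullet> g ?p) / x - w \<bullet> (J ?p *\<^sub>v h) = (w \<bullet> ?D) / x"
      using x by (simp add: shift field_simps)
    have "\<bar>w \<bullet> ?D\<bar> \<le> vec_norm w * vec_norm ?D"
      using w Jp by (intro Cauchy_Schwarz_vec) simp
    also have "\<dots> \<le> vec_norm w * (e' * vec_norm (x \<cdot>\<^sub>v h))"
      using small h by (intro mult_left_mono jac vec_norm_nonneg) auto
    also have "\<dots> = (e' * n) * \<bar>x\<bar>" by (simp add: n_def vec_norm_smult)
    finally have "\<bar>w \<bullet> ?D\<bar> / \<bar>x\<bar> \<le> e' * n" using x by (simp add: field_simps)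
    then show "norm ((w \<bullet> g (z + (t + x) \<cdot>\<^sub>v h) - w \<bullet> g ?p) / x - w \<bullet> (J ?p *\<^sub>v h)) < e"
      unfolding eq using e'(2) by simp
  qed
qed

text \<open>The remainder \<open>w\<close> is paired with itself: the Lipschitz condition makes
  \<open>\<phi>\<close> nonincreasing on the segment, and comparing \<open>\<phi> 1\<close> with
  \<open>\<phi> 0\<close> gives
  \<open>|w|\<^sup>2 \<le> |w| * (L2 / 2 * |h|\<^sup>2)\<close>.\<close>

lemma gradient_taylor:
  assumes grad: "has_gradient d f gf" and J: "has_jacobian d gf Hf" and L: "lipschitz_hessian d L2 Hf"
    and z: "z \<in> carrier_vec d" and h: "h \<in> carrier_vec d"
  shows "vec_norm (gf (z + h) - gf z - Hf z *\<^sub>v h) \<le> L2 / 2 * (vec_norm h)\<^sup>2"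
proof -
  define w where "w = gf (z + h) - gf z - Hf z *\<^sub>v h"
  have gc: "\<And>x. x \<in> carrier_vec d \<Longrightarrow> gf x \<in> carrier_vec d"
    using grad by (simp add: has_gradient_def)
  have Hc: "\<And>x. x \<in> carrier_vec d \<Longrightarrow> Hf x \<in> carrier_mat d d"
    using J by (simp add: has_jacobian_def)
  have zh: "z + t \<cdot>\<^sub>v h \<in> carrier_vec d" for t using z h by simp
  have Hh: "Hf x *\<^sub>v h \<in> carrier_vec d" if "x \<in> carrier_vec d" for x using Hc[OF that] h by simp
  have w: "w \<in> carrier_vec d" using gc[of "z + h"] gc[of z] Hh z h by (simp add: w_def)
  define \<phi> where "\<phi> t = w \<bullet> gf (z + t \<cdot>\<^sub>v h) - t * (w \<bullet> (Hf z *\<^sub>v h))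
      - vec_norm w * L2 * (vec_norm h)\<^sup>2 * t\<^sup>2 / 2" for t
  define \<phi>' where "\<phi>' t = w \<bullet> (Hf (z + t \<cdot>\<^sub>v h) *\<^sub>v h) - w \<bullet> (Hf z *\<^sub>v h)
      - vec_norm w * L2 * (vec_norm h)\<^sup>2 * t" for t
  have deriv: "DERIV \<phi> t :> \<phi>' t" for t
    unfolding \<phi>_def \<phi>'_def
    by (rule derivative_eq_intros has_jacobian_DERIV[OF J z h w gc] refl | simp)+
  have "\<phi> 1 \<le> \<phi> 0"
  proof (rule DERIV_nonpos_imp_nonincreasing[where f = \<phi>])
    fix t :: real assume t: "0 \<le> t" "t \<le> 1"
    have M: "Hf (z + t \<cdot>\<^sub>v h) - Hf z \<in> carrier_mat d d" using Hc[OF zh] Hc[OF z] by (simp add: minus_carrier_mat)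
    have "w \<bullet> (Hf (z + t \<cdot>\<^sub>v h) *\<^sub>v h) - w \<bullet> (Hf z *\<^sub>v h) = w \<bullet> ((Hf (z + t \<cdot>\<^sub>v h) - Hf z) *\<^sub>v h)"
    proof -
      have "(Hf (z + t \<cdot>\<^sub>v h) - Hf z) *\<^sub>v h = Hf (z + t \<cdot>\<^sub>v h) *\<^sub>v h - Hf z *\<^sub>v h"
        by (rule minus_mult_distrib_mat_vec[OF Hc[OF zh] Hc[OF z] h])
      then show ?thesis
        using w[THEN carrier_vecD] Hh[OF zh[of t], THEN carrier_vecD] Hh[OF z, THEN carrier_vecD]
        by (simp add: scalar_prod_diff_right)
    qed
    also have "\<dots> \<le> vec_norm w * vec_norm ((Hf (z + t \<cdot>\<^sub>v h) - Hf z) *\<^sub>v h)"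
      using w Hc[OF z] by (intro order.trans[OF abs_ge_self Cauchy_Schwarz_vec]) simp
    also have "\<dots> \<le> vec_norm w * (op_norm (Hf (z + t \<cdot>\<^sub>v h) - Hf z) * vec_norm h)"
      by (intro mult_left_mono vec_norm_mult_mat_vec_le[OF M h] vec_norm_nonneg)
    also have "\<dots> \<le> vec_norm w * (L2 * vec_norm (z + t \<cdot>\<^sub>v h - z) * vec_norm h)"
      using L zh z by (intro mult_left_mono mult_right_mono) (auto simp: vec_norm_nonneg lipschitz_hessian_def)
    also have "z + t \<cdot>\<^sub>v h - z = t \<cdot>\<^sub>v h" using z h by (intro eq_vecI) auto
    also have "vec_norm w * (L2 * vec_norm (t \<cdot>\<^sub>v h) * vec_norm h) = vec_norm w * L2 * (vec_norm h)\<^sup>2 * t"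
      using t by (simp add: vec_norm_smult power2_eq_square)
    finally have "\<phi>' t \<le> 0" by (simp add: \<phi>'_def)
    then show "\<exists>y. DERIV \<phi> t :> y \<and> y \<le> 0" using deriv by blast
  qed simp
  moreover have "z + 0 \<cdot>\<^sub>v h = z" using z h by (intro eq_vecI) auto
  moreover have "(vec_norm w)\<^sup>2 = w \<bullet> (gf (z + h) - gf z - Hf z *\<^sub>v h)"
    by (simp add: vec_norm_sq flip: w_def)
  moreover have "\<dots> = w \<bullet> gf (z + h) - w \<bullet> gf z - w \<bullet> (Hf z *\<^sub>v h)"
    using w[THEN carrier_vecD] gc[of "z + h", THEN carrier_vecD] gc[of z, THEN carrier_vecD]
      Hh[OF z, THEN carrier_vecD] z h
    by (simp add: scalar_prod_diff_right)
  ultimately have "vec_norm w * vec_norm w \<le> vec_norm w * (L2 / 2 * (vec_norm h)\<^sup>2)"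
    by (simp add: \<phi>_def power2_eq_square)
  then have "vec_norm w \<le> L2 / 2 * (vec_norm h)\<^sup>2 \<or> vec_norm w = 0"
    using vec_norm_nonneg[of w] by (auto simp: mult_le_cancel_left)
  \<comment> \<open>Cancelling \<open>vec_norm w\<close> leaves the case of a zero remainder, where
    the bound itself must be nonnegative; the Lipschitz condition between \<open>z + h\<close> and
    \<open>z\<close> shows this.\<close>
  moreover have "0 \<le> L2 * (vec_norm h)\<^sup>2"
  proof (cases "vec_norm h = 0")
    case False
    have M: "Hf (z + h) - Hf z \<in> carrier_mat d d" using Hc z h by (simp add: minus_carrier_mat)
    have "0 \<le> op_norm (Hf (z + h) - Hf z) * vec_norm h"
      using vec_norm_mult_mat_vec_le[OF M h] vec_norm_nonneg order_trans by blast
    also have "\<dots> \<le> L2 * vec_norm (z + h - z) * vec_norm h"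
      using L z h by (intro mult_right_mono) (auto simp: vec_norm_nonneg lipschitz_hessian_def)
    also have "z + h - z = h" using z h by (intro eq_vecI) auto
    finally show ?thesis by (simp add: power2_eq_square)
  qed simp
  ultimately show ?thesis unfolding w_def[symmetric] by auto
qed

section \<open>The inexact cubic Newton step\<close>

lemma smult_one_mult_mat_vec:
  fixes h :: "real vec"
  assumes "h \<in> carrier_vec d"
  shows "(c \<cdot>\<^sub>m 1\<^sub>m d) *\<^sub>v h = c \<cdot>\<^sub>v h"
proof (rule eq_vecI)
  fix i assume "i < dim_vec (c \<cdot>\<^sub>v h)"
  then have i: "i < d" using assms by simp
  then have "row (c \<cdot>\<^sub>m 1\<^sub>m d) i = c \<cdot>\<^sub>v unit_vec d i" by (intro eq_vecI) auto
  then show "((c \<cdot>\<^sub>m 1\<^sub>m d) *\<^sub>v h) $ i = (c \<cdot>\<^sub>v h) $ i"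
    using assms i by simp
qed (use assms in simp)

text \<open>The factor \<open>t\<^sup>2\<close> of the error comes from \<open>s\<^sup>3 - r\<^sup>3 = (3/2) r (s\<^sup>2 - r\<^sup>2) + (s - r)\<^sup>2 (s + r/2)\<close> and \<open>\<bar>s - r\<bar> \<le> t |u|\<close>.\<close>

lemma vec_norm_cube_le:
  fixes h u :: "real vec"
  assumes dim: "dim_vec u = dim_vec h" and t: "0 \<le> t" "t \<le> 1"
  defines "r \<equiv> vec_norm h" and "n \<equiv> vec_norm u"
  shows "vec_norm (h + t \<cdot>\<^sub>v u) ^ 3 \<le> r ^ 3 + 3 * t * r * (h \<bullet> u) + t\<^sup>2 * (n\<^sup>2 * (3 * r + n))"
proof -
  define s where "s = vec_norm (h + t \<cdot>\<^sub>v u)"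
  have nn: "0 \<le> r" "0 \<le> s" "0 \<le> n" by (simp_all add: r_def s_def n_def vec_norm_nonneg)
  have s2: "s\<^sup>2 = r\<^sup>2 + 2 * t * (h \<bullet> u) + t\<^sup>2 * n\<^sup>2"
    using dim unfolding s_def r_def n_def vec_norm_sq
    by (simp add: scalar_prod_bilinear scalar_prod_commute[of u h]) (simp add: algebra_simps power2_eq_square)
  have "h \<bullet> (h + t \<cdot>\<^sub>v u) = r\<^sup>2 + t * (h \<bullet> u)"
    using dim unfolding r_def vec_norm_sq by (simp add: scalar_prod_bilinear)
  moreover have "\<bar>h \<bullet> (h + t \<cdot>\<^sub>v u)\<bar> \<le> r * s"
    unfolding r_def s_def using dim by (intro Cauchy_Schwarz_vec) simp
  ultimately have "r\<^sup>2 + t * (h \<bullet> u) \<le> r * s" by linarith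
  then have sr: "(s - r)\<^sup>2 \<le> t\<^sup>2 * n\<^sup>2"
    using s2 by (simp add: power2_diff algebra_simps)
  have "s \<le> r + vec_norm (t \<cdot>\<^sub>v u)"
    unfolding s_def r_def using dim by (intro vec_norm_triangle) simp
  also have "\<dots> \<le> r + n"
    using t nn(3) by (simp add: vec_norm_smult n_def mult_left_le_one_le)
  finally have "s \<le> r + n" .
  then have "(s - r)\<^sup>2 * (s + r / 2) \<le> t\<^sup>2 * n\<^sup>2 * (3 * r / 2 + n)"
    using sr nn by (intro mult_mono) auto
  moreover have "s ^ 3 = r ^ 3 + 3 / 2 * r * (s\<^sup>2 - r\<^sup>2) + (s - r)\<^sup>2 * (s + r / 2)"
    by (simp add: field_simps power2_eq_square power3_eq_cube)
  moreover have "3 / 2 * r * (s\<^sup>2 - r\<^sup>2) = 3 * t * r * (h \<bullet> u) + t\<^sup>2 * n\<^sup>2 * (3 / 2 * r)"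
    unfolding s2 by (simp add: algebra_simps)
  moreover have "t\<^sup>2 * n\<^sup>2 * (3 / 2 * r) + t\<^sup>2 * n\<^sup>2 * (3 * r / 2 + n) = t\<^sup>2 * (n\<^sup>2 * (3 * r + n))"
    by (simp add: algebra_simps)
  ultimately show ?thesis unfolding s_def[symmetric] by linarith
qed

text \<open>Replaces the limit \<open>t \<rightarrow> 0\<close> when a first-order term is compared
  with a second-order error.\<close>

lemma nonpos_if_le_all_small_multiples:
  fixes p K :: real
  assumes "\<And>t. 0 < t \<Longrightarrow> t \<le> 1 \<Longrightarrow> p \<le> t * K"
  shows "p \<le> 0"
proof (rule ccontr)
  assume "\<not> p \<le> 0"
  define M where "M = \<bar>K\<bar> + 1"
  have M: "0 < M" "\<bar>K\<bar> \<le> M" by (auto simp: M_def)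
  define t where "t = min 1 (p / (2 * M))"
  have t: "0 < t" "t \<le> 1" using \<open>\<not> p \<le> 0\<close> M by (auto simp: t_def)
  have "p \<le> t * K" using assms[OF t] .
  also have "\<dots> \<le> t * \<bar>K\<bar>" using t by (intro mult_left_mono) auto
  also have "\<dots> \<le> p / (2 * M) * M"
    using t M \<open>\<not> p \<le> 0\<close> by (intro mult_mono) (auto simp: t_def)
  also have "\<dots> = p / 2" using M by simp
  finally show False using \<open>\<not> p \<le> 0\<close> by simp
qed

text \<open>Moving from the minimizer along the negative model gradient \<open>u\<close> changes the
  model by at most \<open>- t * n\<^sup>2 + t\<^sup>2 * K\<close>, and minimality forbids a
  decrease. The regularization and the cubic term contribute
  \<open>(2 * \<delta> + L2 * r) h = lam h\<close> to that gradient.\<close>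

lemma cubic_model_stationary:
  assumes Hz: "H z \<in> carrier_mat d d" "H z = transpose_mat (H z)"
    and g: "gf z \<in> carrier_vec d" and z: "z \<in> carrier_vec d" and L: "0 \<le> L2"
    and newton: "cubic_newton_oracle d gf H \<delta> L2 z y lam"
  shows "vec_norm (gf z + H z *\<^sub>v (y - z) + lam \<cdot>\<^sub>v (y - z)) = 0"
proof -
  let ?m = "cubic_model d gf H \<delta> L2 z"
  define h where "h = y - z"
  define B where "B = H z + (2 * \<delta>) \<cdot>\<^sub>m 1\<^sub>m d"
  define r where "r = vec_norm h"
  define u where "u = - (gf z + H z *\<^sub>v h + lam \<cdot>\<^sub>v h)"
  define n where "n = vec_norm u"
  have y: "y \<in> carrier_vec d" and min: "\<And>x. x \<in> carrier_vec d \<Longrightarrow> ?m y \<le> ?m x"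
    and lam: "lam = 2 * \<delta> + L2 * r"
    using newton by (auto simp: cubic_newton_oracle_def is_arg_min_linorder r_def h_def)
  have h: "h \<in> carrier_vec d" and u: "u \<in> carrier_vec d"
    using y z g Hz by (auto simp: h_def u_def)
  have B: "B \<in> carrier_mat d d" using Hz by (simp add: B_def)
  have "transpose_mat ((2 * \<delta>) \<cdot>\<^sub>m 1\<^sub>m d) = (2 * \<delta>) \<cdot>\<^sub>m 1\<^sub>m d" by (intro eq_matI) auto
  then have symB: "transpose_mat B = B"
    unfolding B_def using Hz by (subst transpose_add[of _ d d]) auto
  have Bh: "B *\<^sub>v h \<in> carrier_vec d" and Bu: "B *\<^sub>v u \<in> carrier_vec d" using B h u by auto
  note dims = h[THEN carrier_vecD] u[THEN carrier_vecD] g[THEN carrier_vecD]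
    Bh[THEN carrier_vecD] Bu[THEN carrier_vecD]
  have Bhu: "(B *\<^sub>v u) \<bullet> h = (B *\<^sub>v h) \<bullet> u"
    using transpose_vec_mult_scalar[OF B h u] dims by (simp add: symB scalar_prod_commute)
  have Bh_eq: "B *\<^sub>v h = H z *\<^sub>v h + (2 * \<delta>) \<cdot>\<^sub>v h"
    unfolding B_def using h Hz
    by (subst add_mult_distrib_mat_vec[of _ d d]) (auto simp: smult_one_mult_mat_vec)
  \<comment> \<open>The left side is the directional derivative of the model at \<open>y\<close>
    along \<open>u\<close>.\<close>
  have slope: "gf z \<bullet> u + (B *\<^sub>v h) \<bullet> u + L2 * r * (h \<bullet> u) = - (n\<^sup>2)"
  proof -
    have "gf z + H z *\<^sub>v h + lam \<cdot>\<^sub>v h = gf z + B *\<^sub>v h + (L2 * r) \<cdot>\<^sub>v h"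
      unfolding Bh_eq lam using g h Hz by (intro eq_vecI) (auto simp: algebra_simps)
    then have "- u = gf z + B *\<^sub>v h + (L2 * r) \<cdot>\<^sub>v h" by (simp add: u_def)
    then have "(- u) \<bullet> u = gf z \<bullet> u + (B *\<^sub>v h) \<bullet> u + L2 * r * (h \<bullet> u)"
      using dims by (simp add: scalar_prod_bilinear)
    then show ?thesis by (simp add: n_def vec_norm_sq)
  qed
  \<comment> \<open>\<open>K\<close> collects the second-order terms: the quadratic form along
    \<open>u\<close> and the error of \<open>vec_norm_cube_le\<close>.\<close>
  define K where "K = (B *\<^sub>v u) \<bullet> u / 2 + L2 / 3 * (n\<^sup>2 * (3 * r + n))"
  have "n\<^sup>2 \<le> t * K" if t: "0 < t" "t \<le> 1" for t
  proof -
    have step: "y + t \<cdot>\<^sub>v u - z = h + t \<cdot>\<^sub>v u"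
      unfolding h_def using y z u by (intro eq_vecI) auto
    have "B *\<^sub>v (h + t \<cdot>\<^sub>v u) = B *\<^sub>v h + t \<cdot>\<^sub>v (B *\<^sub>v u)"
      using B h u by (subst mult_add_distrib_mat_vec[of _ d d]) (auto simp: mult_mat_vec[of _ d d])
    then have quad: "(B *\<^sub>v (h + t \<cdot>\<^sub>v u)) \<bullet> (h + t \<cdot>\<^sub>v u)
        = (B *\<^sub>v h) \<bullet> h + 2 * t * ((B *\<^sub>v h) \<bullet> u) + t\<^sup>2 * ((B *\<^sub>v u) \<bullet> u)"
      using dims by (simp add: scalar_prod_bilinear Bhu) (simp add: algebra_simps power2_eq_square)
    have lin: "gf z \<bullet> (h + t \<cdot>\<^sub>v u) = gf z \<bullet> h + t * (gf z \<bullet> u)"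
      using dims by (simp add: scalar_prod_bilinear)
    have "vec_norm (h + t \<cdot>\<^sub>v u) ^ 3 \<le> r ^ 3 + 3 * t * r * (h \<bullet> u) + t\<^sup>2 * (n\<^sup>2 * (3 * r + n))"
      unfolding r_def n_def using dims t by (intro vec_norm_cube_le) auto
    then have cube: "L2 / 3 * vec_norm (h + t \<cdot>\<^sub>v u) ^ 3
        \<le> L2 / 3 * (r ^ 3 + 3 * t * r * (h \<bullet> u) + t\<^sup>2 * (n\<^sup>2 * (3 * r + n)))"
      using L by (intro mult_left_mono) auto
    have "?m y \<le> ?m (y + t \<cdot>\<^sub>v u)" using y u by (intro min) auto
    then have "L2 / 3 * r ^ 3 \<le> t * (gf z \<bullet> u) + t * ((B *\<^sub>v h) \<bullet> u) + t\<^sup>2 * ((B *\<^sub>v u) \<bullet> u) / 2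
        + L2 / 3 * vec_norm (h + t \<cdot>\<^sub>v u) ^ 3"
      unfolding cubic_model_def step B_def[symmetric] h_def[symmetric] r_def[symmetric] quad lin
      by (simp add: algebra_simps)
    also have "\<dots> \<le> L2 / 3 * r ^ 3
        + t * (gf z \<bullet> u + (B *\<^sub>v h) \<bullet> u + L2 * r * (h \<bullet> u)) + t\<^sup>2 * K"
      using cube by (simp add: K_def algebra_simps)
    finally have "t * n\<^sup>2 \<le> t * (t * K)"
      unfolding slope by (simp add: power2_eq_square algebra_simps)
    then show ?thesis using t by simp
  qed
  then have "n\<^sup>2 \<le> 0" by (rule nonpos_if_le_all_small_multiples)
  then have "vec_norm (- u) = 0" by (simp add: n_def vec_norm_uminus)
  then show ?thesis by (simp add: u_def h_def)
qed

text \<open>The residual splits into the Taylor remainder, the estimator error and the vanishing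
  model gradient. The first two bounds, \<open>L2 / 2 * |h|\<^sup>2\<close> and
  \<open>\<delta> * |h|\<close>, add up to exactly \<open>lam / 2 * |h|\<close>; the shift by
  \<open>2 * \<delta>\<close> pays for the estimator.\<close>

lemma cubic_newton_oracle_Monteiro_Svaiter:
  assumes f: "twice_cont_differentiable d f gf Hf" "lipschitz_hessian d L2 Hf"
    and est: "hessian_estimator d \<delta> Hf H" and L: "0 \<le> L2" and z: "z \<in> carrier_vec d"
    and newton: "cubic_newton_oracle d gf H \<delta> L2 z y lam"
  shows "vec_norm (gf y + lam \<cdot>\<^sub>v (y - z)) \<le> lam / 2 * vec_norm (y - z)"
proof -
  define h where "h = y - z"
  have grad: "has_gradient d f gf" and J: "has_jacobian d gf Hf"
    using f by (auto simp: twice_cont_differentiable_def)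
  have y: "y \<in> carrier_vec d" and lam: "lam = 2 * \<delta> + L2 * vec_norm h"
    using newton by (auto simp: cubic_newton_oracle_def is_arg_min_linorder h_def)
  have h: "h \<in> carrier_vec d" using y z by (simp add: h_def)
  have gy: "gf y \<in> carrier_vec d" and gz: "gf z \<in> carrier_vec d"
    using grad y z by (auto simp: has_gradient_def)
  have Hf: "Hf z \<in> carrier_mat d d" using J z by (auto simp: has_jacobian_def)
  have H: "H z \<in> carrier_mat d d" "H z = transpose_mat (H z)" and err: "op_norm (H z - Hf z) \<le> \<delta>"
    using est z by (auto simp: hessian_estimator_def)
  let ?p = "gf y - gf z - Hf z *\<^sub>v h" and ?e = "(H z - Hf z) *\<^sub>v h"
    and ?q = "gf z + H z *\<^sub>v h + lam \<cdot>\<^sub>v h"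
  have zh: "z + h = y" unfolding h_def using y z by (intro eq_vecI) auto
  have p: "vec_norm ?p \<le> L2 / 2 * (vec_norm h)\<^sup>2"
    using gradient_taylor[OF grad J f(2) z h] by (simp add: zh)
  have "vec_norm ?e \<le> op_norm (H z - Hf z) * vec_norm h"
    using h Hf by (intro vec_norm_mult_mat_vec_le[of _ d d]) (auto simp: minus_carrier_mat)
  also have "\<dots> \<le> \<delta> * vec_norm h" using err by (intro mult_right_mono vec_norm_nonneg)
  finally have e: "vec_norm ?e \<le> \<delta> * vec_norm h" .
  have q: "vec_norm ?q = 0"
    using cubic_model_stationary[OF H gz z L newton] by (simp add: h_def)
  have "?e = H z *\<^sub>v h - Hf z *\<^sub>v h" by (rule minus_mult_distrib_mat_vec[OF H(1) Hf h])
  moreover have "H z *\<^sub>v h \<in> carrier_vec d" "Hf z *\<^sub>v h \<in> carrier_vec d" using H Hf h by auto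
  ultimately have "gf y + lam \<cdot>\<^sub>v h = ?p + (- ?e + ?q)"
    using gy gz h H Hf by (intro eq_vecI) (auto simp del: index_mult_mat_vec)
  moreover have "vec_norm (?p + (- ?e + ?q)) \<le> vec_norm ?p + (vec_norm ?e + vec_norm ?q)"
    using vec_norm_triangle[of ?p "- ?e + ?q"] vec_norm_triangle[of "- ?e" ?q] gy gz h H Hf
    by (simp add: vec_norm_uminus)
  ultimately have "vec_norm (gf y + lam \<cdot>\<^sub>v h) \<le> L2 / 2 * (vec_norm h)\<^sup>2 + \<delta> * vec_norm h"
    using p e q by simp
  also have "\<dots> = lam / 2 * vec_norm h" by (simp add: lam power2_eq_square algebra_simps)
  finally show ?thesis by (simp add: h_def)
qed

text \<open>Here \<open>p\<close> stands for \<open>\<lambda>'\<close> and \<open>b\<close>, \<open>B\<close> for \<open>a'\<close>, \<open>A'\<close>; the equation for \<open>b\<close> is what makes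
  \<open>a\<^sup>2\<close> comparable to \<open>\<beta> A'/\<lambda>\<close>, so that the Monteiro-Svaiter condition absorbs the squared
  gradient norm.\<close>

lemma estimate_sequence_step:
  fixes x v z y g xs :: "real vec"
  assumes car: "x \<in> carrier_vec d" "v \<in> carrier_vec d" "y \<in> carrier_vec d"
      "g \<in> carrier_vec d" "xs \<in> carrier_vec d"
    and z: "z = (1 / B) \<cdot>\<^sub>v (A \<cdot>\<^sub>v x + b \<cdot>\<^sub>v v)"
    and B: "B = A + b" "0 < B" and A: "0 \<le> A" and b: "0 \<le> b" "p * b\<^sup>2 = B" and p: "0 < p"
    and \<beta>: "0 \<le> \<beta>" "\<beta> * lam \<le> p" and lam: "0 \<le> lam"
    and MS: "vec_norm (g + lam \<cdot>\<^sub>v (y - z)) \<le> lam / 2 * vec_norm (y - z)"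
    and gx: "fy + g \<bullet> (x - y) \<le> fx" and gs: "fy + g \<bullet> (xs - y) \<le> fs"
  shows "(vec_norm (v - (\<beta> * b) \<cdot>\<^sub>v g - xs))\<^sup>2 / 2 + \<beta> * B * (fy - fs)
    \<le> (vec_norm (v - xs))\<^sup>2 / 2 + \<beta> * A * (fx - fs) - 3/8 * (\<beta> * B * lam * (vec_norm (y - z))\<^sup>2)"
proof -
  define P Q r where "P = g \<bullet> (z - y)" and "Q = g \<bullet> g" and "r = vec_norm (y - z)"
  have zc: "z \<in> carrier_vec d" using z car by simp
  note dims = car[THEN carrier_vecD] zc[THEN carrier_vecD]
  have "B \<cdot>\<^sub>v z = A \<cdot>\<^sub>v x + b \<cdot>\<^sub>v v"
    using z B(2) car by (intro eq_vecI) auto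
  then have "g \<bullet> (B \<cdot>\<^sub>v z) = g \<bullet> (A \<cdot>\<^sub>v x + b \<cdot>\<^sub>v v)" by simp
  then have Bz: "B * (g \<bullet> z) = A * (g \<bullet> x) + b * (g \<bullet> v)"
    using dims by (simp add: scalar_prod_bilinear)
  \<comment> \<open>Since \<open>B z = A x + b v\<close>, the vector \<open>b (v - xs)\<close> is
    \<open>B (z - y) + A (y - x) + b (y - xs)\<close>; the last two summands call for the two
    subgradient inequalities.\<close>
  have inner: "b * (g \<bullet> (v - xs)) = B * P + A * (g \<bullet> (y - x)) + b * (g \<bullet> (y - xs))"
    using dims Bz by (simp add: scalar_prod_bilinear P_def B(1) algebra_simps)
  have "A * (g \<bullet> (y - x)) \<ge> A * (fy - fx)" "b * (g \<bullet> (y - xs)) \<ge> b * (fy - fs)"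
    using A b gx gs dims by (intro mult_left_mono; simp add: scalar_prod_bilinear)+
  then have "b * (g \<bullet> (v - xs)) \<ge> B * P + B * (fy - fs) - A * (fx - fs)"
    unfolding inner B(1) by (simp add: algebra_simps)
  then have "\<beta> * (b * (g \<bullet> (v - xs))) \<ge> \<beta> * (B * P + B * (fy - fs) - A * (fx - fs))"
    using \<beta>(1) by (rule mult_left_mono)
  moreover have "(vec_norm (v - (\<beta> * b) \<cdot>\<^sub>v g - xs))\<^sup>2
      = (vec_norm (v - xs))\<^sup>2 - 2 * (\<beta> * (b * (g \<bullet> (v - xs)))) + (\<beta> * b)\<^sup>2 * Q"
    using dims unfolding vec_norm_sq Q_def
    by (simp add: scalar_prod_bilinear scalar_prod_commute[of v g] scalar_prod_commute[of xs g])
      (simp add: algebra_simps power2_eq_square)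
  moreover have "(\<beta> * b)\<^sup>2 * Q / 2 + 3/8 * (\<beta> * B * lam * r\<^sup>2) \<le> \<beta> * B * P"
  proof -
    have "(vec_norm (g + lam \<cdot>\<^sub>v (y - z)))\<^sup>2 \<le> (lam / 2 * r)\<^sup>2"
      using MS by (auto simp: r_def vec_norm_nonneg intro: power_mono)
    moreover have "(vec_norm (g + lam \<cdot>\<^sub>v (y - z)))\<^sup>2 = Q - 2 * lam * P + lam\<^sup>2 * r\<^sup>2"
      using dims unfolding vec_norm_sq Q_def P_def r_def
      by (simp add: scalar_prod_bilinear scalar_prod_commute[of y g] scalar_prod_commute[of z g])
        (simp add: algebra_simps power2_eq_square)
    \<comment> \<open>The 3/4 is \<open>1 - (1/2)\<^sup>2\<close>; halved, it becomes the 3/8 of the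
      decrease.\<close>
    ultimately have MS': "Q - 2 * lam * P + 3/4 * (lam\<^sup>2 * r\<^sup>2) \<le> 0"
      by (simp add: power_mult_distrib power_divide)
    show ?thesis
    proof (cases "lam = 0")
      case True
      then have "vec_norm g \<le> 0" using MS' power2_le_imp_le[of "vec_norm g" 0] by (simp add: Q_def vec_norm_sq)
      then have "P = 0" "Q = 0"
        using dims scalar_prod_eq_0_if_vec_norm_le_0[of g "z - y"] scalar_prod_eq_0_if_vec_norm_le_0[of g g]
        by (simp_all add: P_def Q_def scalar_prod_commute[of g "z - y"])
      then show ?thesis using True by simp
    next
      case False
      have "\<beta> * lam * (\<beta> * b\<^sup>2) \<le> p * (\<beta> * b\<^sup>2)"
        using \<beta> by (intro mult_right_mono) auto
      also have "\<dots> = \<beta> * B" using b(2) by (simp add: algebra_simps)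
      finally have "lam * (\<beta> * b)\<^sup>2 \<le> \<beta> * B" by (simp add: power_mult_distrib power2_eq_square algebra_simps)
      then have "lam * (\<beta> * b)\<^sup>2 * Q \<le> \<beta> * B * Q"
        by (intro mult_right_mono) (auto simp: Q_def scalar_prod_self_nonneg)
      moreover have "\<beta> * B * (Q - 2 * lam * P + 3/4 * (lam\<^sup>2 * r\<^sup>2)) \<le> 0"
        using MS' \<beta> B by (intro mult_nonneg_nonpos) auto
      ultimately have "lam * ((\<beta> * b)\<^sup>2 * Q / 2 + 3/8 * (\<beta> * B * lam * r\<^sup>2)) \<le> lam * (\<beta> * B * P)"
        by (simp add: algebra_simps power2_eq_square)
      then show ?thesis using False lam by simp
    qed
  qed
  ultimately show ?thesis unfolding r_def[symmetric] by (simp add: algebra_simps)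
qed

section \<open>Growth of the estimate sequence\<close>

definition growth :: "real \<Rightarrow> real \<Rightarrow> real \<Rightarrow> real \<Rightarrow> real" where
  "growth D0 \<delta> L2 A = sqrt (\<delta> * A) + (D0 * L2\<^sup>2) powr (1/7) * A powr (2/7)"

text \<open>Writing positive reals as seventh powers turns the exponents 1/7, 2/7 and 3/7 into
  integers, so that comparing \<open>growth\<close> with \<open>guess_scale\<close> becomes algebra
  in \<open>p\<close> and \<open>q\<close>.\<close>

lemma power7_powr:
  fixes q :: real
  assumes "0 < q"
  shows "(q ^ 7) powr (real k / 7) = q ^ k"
proof -
  have "q ^ 7 = q powr 7" using assms by simp
  then have "(q ^ 7) powr (real k / 7) = q powr real k" by (simp add: powr_powr)
  then show ?thesis using assms by (simp add: powr_realpow)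
qed

lemma power7_surj:
  fixes x :: real
  assumes "0 < x"
  obtains q where "0 < q" "x = q ^ 7"
proof
  show "0 < root 7 x" "x = root 7 x ^ 7"
    using assms by (simp_all add: real_root_gt_zero)
qed

lemma growth_power7:
  assumes "0 < p" "0 < q" "D0 * L2\<^sup>2 = p ^ 7"
  shows "growth D0 \<delta> L2 (q ^ 7) = sqrt (\<delta> * q ^ 7) + p * q\<^sup>2"
  using power7_powr[OF assms(1), of 1] power7_powr[OF assms(2), of 2] assms(3)
  by (simp add: growth_def)

lemma guess_scale_power7:
  assumes "0 < p" "0 < q" "D0 * L2\<^sup>2 = p ^ 7"
  shows "guess_scale D0 \<delta> L2 (q ^ 7) = \<delta> + p\<^sup>2 / q ^ 3"
proof -
  have "((q ^ 7) powr (3/2)) powr (2/7) = q ^ 3"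
    using power7_powr[OF assms(2), of 3] by (simp add: powr_powr)
  moreover have "(p ^ 7) powr (2/7) = p\<^sup>2"
    using power7_powr[OF assms(1), of 2] by simp
  ultimately have "(p ^ 7 / (q ^ 7) powr (3/2)) powr (2/7) = p\<^sup>2 / q ^ 3"
    using assms by (simp add: powr_divide)
  then show ?thesis by (simp add: guess_scale_def assms(3))
qed

lemma guess_scale_ge: "\<delta> \<le> guess_scale D0 \<delta> L2 A"
  by (simp add: guess_scale_def)

text \<open>The bounds \<open>ln (1 + \<theta>) \<ge> \<theta> / (1 + \<theta>) \<ge> \<theta> /
  2\<close> and \<open>exp x \<ge> 1 + x\<close> give half of the exponent 2/7 as slope.\<close>

lemma powr_two_sevenths_ge:
  fixes \<theta> :: real
  assumes "0 \<le> \<theta>" "\<theta> \<le> 1"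
  shows "1 + \<theta> / 7 \<le> (1 + \<theta>) powr (2/7)"
proof -
  have "ln (1 / (1 + \<theta>)) \<le> 1 / (1 + \<theta>) - 1" using assms by (intro ln_le_minus_one) auto
  then have "\<theta> / (1 + \<theta>) \<le> ln (1 + \<theta>)" using assms by (simp add: ln_div field_simps)
  moreover have "\<theta> / 2 \<le> \<theta> / (1 + \<theta>)" using assms by (intro divide_left_mono) auto
  ultimately have "1 + \<theta> / 7 \<le> 1 + 2/7 * ln (1 + \<theta>)" by linarith
  also have "\<dots> \<le> exp (2/7 * ln (1 + \<theta>))" by (rule exp_ge_add_one_self)
  finally show ?thesis using assms by (simp add: powr_def)
qed

section \<open>Dependence of the guess scale and the growth function on \<open>A\<close>\<close>

context
  fixes D0 \<delta> L2 :: real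
  assumes pos: "0 < D0" "0 \<le> \<delta>" "0 < L2"
begin

lemma D0_L2_power7:
  obtains p where "0 < p" "D0 * L2\<^sup>2 = p ^ 7"
  using power7_surj[of "D0 * L2\<^sup>2"] pos by auto

lemma growth_pos: "0 < A \<Longrightarrow> 0 < growth D0 \<delta> L2 A"
  using pos by (auto simp: growth_def intro!: add_nonneg_pos)

lemma growth_mono: "0 \<le> A \<Longrightarrow> A \<le> B \<Longrightarrow> growth D0 \<delta> L2 A \<le> growth D0 \<delta> L2 B"
  unfolding growth_def using pos
  by (intro add_mono mult_left_mono powr_mono2 real_sqrt_le_mono) auto

lemma guess_scale_pos: "0 < A \<Longrightarrow> 0 < guess_scale D0 \<delta> L2 A"
  using pos by (auto simp: guess_scale_def intro!: add_nonneg_pos)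

lemma guess_scale_antimono:
  assumes "0 < A" "A \<le> B"
  shows "guess_scale D0 \<delta> L2 B \<le> guess_scale D0 \<delta> L2 A"
  unfolding guess_scale_def using pos assms
  by (intro add_left_mono powr_mono2 divide_left_mono) (auto intro: powr_mono2)

text \<open>Halving the argument multiplies the second summand by
  \<open>2 powr (3/7) \<le> 2\<close>. Hence a stored guess keeps the right order until
  \<open>A\<close> has doubled.\<close>

lemma guess_scale_le_double:
  assumes "0 < A" "A \<le> B" "B \<le> 2 * A"
  shows "guess_scale D0 \<delta> L2 A \<le> 2 * guess_scale D0 \<delta> L2 B"
proof -
  let ?P = "D0 * L2\<^sup>2"
  have B: "0 < B" using assms by simp
  define X where "X = ?P / B powr (3/2)"
  have X: "0 \<le> X" using pos by (simp add: X_def)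
  have "guess_scale D0 \<delta> L2 A \<le> \<delta> + (?P / (B / 2) powr (3/2)) powr (2/7)"
    using guess_scale_antimono[of "B / 2" A] assms by (simp add: guess_scale_def)
  also have "?P / (B / 2) powr (3/2) = 2 powr (3/2) * X"
    using B by (simp add: powr_divide X_def)
  also have "\<dots> powr (2/7) = 2 powr (3/7) * X powr (2/7)"
    using X by (simp add: powr_mult powr_powr)
  also have "\<dots> \<le> 2 * X powr (2/7)"
    using powr_mono[of "3/7" 1 "2::real"] by (intro mult_right_mono) auto
  also have "\<delta> + \<dots> \<le> 2 * guess_scale D0 \<delta> L2 B"
    using pos by (simp add: guess_scale_def X_def)
  finally show ?thesis by simp
qed

text \<open>The left side is the sum of the squares of the two summands of
  \<open>growth\<close>.\<close>

lemma guess_scale_mult_le_growth_sq: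
  assumes "0 < A"
  shows "A * guess_scale D0 \<delta> L2 A \<le> (growth D0 \<delta> L2 A)\<^sup>2"
proof -
  obtain p where p: "0 < p" "D0 * L2\<^sup>2 = p ^ 7" by (rule D0_L2_power7)
  obtain q where q: "0 < q" "A = q ^ 7" using assms by (rule power7_surj)
  have "q ^ 7 * (\<delta> + p\<^sup>2 / q ^ 3) = (sqrt (\<delta> * q ^ 7))\<^sup>2 + (p * q\<^sup>2)\<^sup>2"
    using pos q(1) by (simp add: field_simps eval_nat_numeral)
  also have "\<dots> \<le> (sqrt (\<delta> * q ^ 7) + p * q\<^sup>2)\<^sup>2"
    using pos p q by (simp add: power2_sum)
  finally show ?thesis
    using p q by (simp add: guess_scale_power7 growth_power7)
qed

text \<open>For \<open>\<delta> = 0\<close> the exponents match and equality holds; a positive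
  \<open>\<delta>\<close> only enlarges the factors on the right.\<close>

lemma growth_mult_guess_scale_cube_ge:
  assumes "0 < A"
  shows "D0 * L2\<^sup>2 \<le> growth D0 \<delta> L2 A * (A * guess_scale D0 \<delta> L2 A ^ 3)"
proof -
  obtain p where p: "0 < p" "D0 * L2\<^sup>2 = p ^ 7" by (rule D0_L2_power7)
  obtain q where q: "0 < q" "A = q ^ 7" using assms by (rule power7_surj)
  have "p ^ 7 = p * q\<^sup>2 * (q ^ 7 * (p\<^sup>2 / q ^ 3) ^ 3)"
    using q(1) by (simp add: field_simps eval_nat_numeral)
  also have "\<dots> \<le> (sqrt (\<delta> * q ^ 7) + p * q\<^sup>2) * (q ^ 7 * (\<delta> + p\<^sup>2 / q ^ 3) ^ 3)"
    using pos p q by (intro mult_mono power_mono) auto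
  finally show ?thesis
    using p q by (simp add: guess_scale_power7 growth_power7)
qed

text \<open>The hypothesis is what \<open>A_1\<close> proves about the first iteration. One of its
  summands is at least 1/2. For the second, squaring shows
  \<open>(p * q\<^sup>2) ^ 7 \<ge> 1/16\<close>, and numbers in \<open>[0, 1]\<close> dominate their
  seventh powers.\<close>

lemma growth_ge_const:
  assumes "0 < A" "1 \<le> A * (2 * \<delta> + 2 * L2 * sqrt D0)"
  shows "1 / 16 \<le> growth D0 \<delta> L2 A"
proof -
  obtain p where p: "0 < p" "D0 * L2\<^sup>2 = p ^ 7" by (rule D0_L2_power7)
  obtain q where q: "0 < q" "A = q ^ 7" using assms(1) by (rule power7_surj)
  have nn: "0 \<le> sqrt (\<delta> * A)" "0 \<le> p * q\<^sup>2" using pos p q assms by auto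
  have g: "growth D0 \<delta> L2 A = sqrt (\<delta> * A) + p * q\<^sup>2"
    using p q by (simp add: growth_power7)
  have "1/4 \<le> \<delta> * A \<or> 1/4 \<le> L2 * sqrt D0 * A"
    using assms(2) by (auto simp: algebra_simps)
  then show ?thesis
  proof
    assume "1/4 \<le> \<delta> * A"
    then have "1/16 \<le> sqrt (\<delta> * A)" by (intro real_le_rsqrt) (simp add: power2_eq_square)
    then show ?thesis using nn unfolding g by linarith
  next
    assume "1/4 \<le> L2 * sqrt D0 * A"
    then have "(1/4)\<^sup>2 \<le> (L2 * sqrt D0 * A)\<^sup>2" by (intro power_mono) auto
    also have "\<dots> = p ^ 7 * (q ^ 7)\<^sup>2"
      using pos by (simp add: power_mult_distrib q(2) flip: p(2))
    also have "\<dots> = (p * q\<^sup>2) ^ 7" by (simp add: power_mult_distrib flip: power_mult)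
    finally have ge: "1/16 \<le> (p * q\<^sup>2) ^ 7" by (simp add: power2_eq_square)
    have "1/16 \<le> p * q\<^sup>2"
    proof (rule ccontr)
      assume neg: "\<not> 1/16 \<le> p * q\<^sup>2"
      then have "(p * q\<^sup>2) ^ 7 \<le> (p * q\<^sup>2) ^ 1" using nn by (intro power_decreasing) auto
      with ge neg show False by simp
    qed
    then show ?thesis using nn unfolding g by linarith
  qed
qed

lemma growth_scaled_ge:
  assumes \<theta>: "0 \<le> \<theta>" "\<theta> \<le> 1" and A: "0 < A"
  shows "(1 + \<theta> / 7) * growth D0 \<delta> L2 A \<le> growth D0 \<delta> L2 ((1 + \<theta>) * A)"
proof -
  have "(1 + \<theta> / 7)\<^sup>2 = 1 + 2/7 * \<theta> + \<theta> * \<theta> / 49" by (simp add: power2_eq_square algebra_simps)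
  also have "\<dots> \<le> 1 + \<theta>" using \<theta> mult_left_le[of \<theta> \<theta>] by simp
  finally have "1 + \<theta> / 7 \<le> sqrt (1 + \<theta>)" by (rule real_le_rsqrt)
  then have "(1 + \<theta> / 7) * sqrt (\<delta> * A) \<le> sqrt (1 + \<theta>) * sqrt (\<delta> * A)"
    using pos A by (intro mult_right_mono) auto
  also have "\<dots> = sqrt (\<delta> * ((1 + \<theta>) * A))" by (simp add: real_sqrt_mult)
  finally have *: "(1 + \<theta> / 7) * sqrt (\<delta> * A) \<le> sqrt (\<delta> * ((1 + \<theta>) * A))" .
  have "(1 + \<theta> / 7) * A powr (2/7) \<le> (1 + \<theta>) powr (2/7) * A powr (2/7)"
    using powr_two_sevenths_ge[OF \<theta>] by (intro mult_right_mono) auto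
  also have "\<dots> = ((1 + \<theta>) * A) powr (2/7)" using \<theta> A by (simp add: powr_mult)
  finally have "(D0 * L2\<^sup>2) powr (1/7) * ((1 + \<theta> / 7) * A powr (2/7))
      \<le> (D0 * L2\<^sup>2) powr (1/7) * ((1 + \<theta>) * A) powr (2/7)"
    by (intro mult_left_mono) auto
  with * show ?thesis unfolding growth_def by (simp add: algebra_simps)
qed

text \<open>The step multiplies \<open>A\<close> by at least \<open>1 + \<theta>\<close>, where
  \<open>\<theta>\<close> is inversely proportional to the growth \<open>g\<close>;
  \<open>growth_scaled_ge\<close> turns this into a gain \<open>\<theta> * g / 7\<close>, in which
  \<open>g\<close> cancels. Capping \<open>\<theta>\<close> at 1 produces the minimum.\<close>

lemma growth_increment:
  assumes A: "0 < A" and K: "0 < K" and k: "0 < k"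
    and p: "0 < p" "p \<le> k * guess_scale D0 \<delta> L2 A" and a: "sqrt (A / p) / K \<le> a"
  shows "growth D0 \<delta> L2 A + min (growth D0 \<delta> L2 A) (1 / (K * sqrt k)) / 7 \<le> growth D0 \<delta> L2 (A + a)"
proof -
  define g where "g = growth D0 \<delta> L2 A"
  have g: "0 < g" using growth_pos[OF A] by (simp add: g_def)
  define \<theta> where "\<theta> = min 1 (1 / (K * sqrt k * g))"
  have \<theta>: "0 \<le> \<theta>" "\<theta> \<le> 1" using K k g by (auto simp: \<theta>_def)
  have "p * A \<le> k * (A * guess_scale D0 \<delta> L2 A)"
    using mult_right_mono[OF p(2), of A] A by (simp add: algebra_simps)
  also have "\<dots> \<le> k * g\<^sup>2"
    using guess_scale_mult_le_growth_sq[OF A] k by (simp add: g_def)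
  finally have pA: "p * A \<le> k * g\<^sup>2" .
  have "A / (sqrt k * g) \<le> sqrt (A / p)"
  proof (rule real_le_rsqrt)
    have "A * A * p \<le> A * (k * g\<^sup>2)" using mult_left_mono[OF pA, of A] A by (simp add: algebra_simps)
    then show "(A / (sqrt k * g))\<^sup>2 \<le> A / p"
      using A k g p by (simp add: power_divide power_mult_distrib field_simps power2_eq_square)
  qed
  then have "A / (sqrt k * g) / K \<le> a" using a K by (meson divide_right_mono less_imp_le order_trans)
  moreover have "\<theta> * A \<le> 1 / (K * sqrt k * g) * A" using A by (intro mult_right_mono) (auto simp: \<theta>_def)
  moreover have "1 / (K * sqrt k * g) * A = A / (sqrt k * g) / K" by simp
  ultimately have "(1 + \<theta>) * A \<le> A + a" by (simp add: algebra_simps)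
  have "\<theta> * g = min g (1 / (K * sqrt k))"
    using g K k by (simp add: \<theta>_def min_mult_distrib_right)
  then have "g + min g (1 / (K * sqrt k)) / 7 = (1 + \<theta> / 7) * g" by (simp add: algebra_simps)
  also have "\<dots> \<le> growth D0 \<delta> L2 ((1 + \<theta>) * A)"
    unfolding g_def by (rule growth_scaled_ge[OF \<theta> A])
  also have "\<dots> \<le> growth D0 \<delta> L2 (A + a)"
    using \<open>(1 + \<theta>) * A \<le> A + a\<close> A \<theta> by (intro growth_mono) auto
  finally show ?thesis by (simp add: g_def)
qed

lemma growth_at_target:
  assumes "0 < \<epsilon>"
  shows "growth D0 \<delta> L2 (D0 / \<epsilon>) \<le>
    (sqrt D0 + D0 powr (3/7)) * ((\<delta> / \<epsilon>) powr (1/2) + (L2 / \<epsilon>) powr (2/7))"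
proof -
  have "sqrt (\<delta> * (D0 / \<epsilon>)) = sqrt D0 * (\<delta> / \<epsilon>) powr (1/2)"
    using pos assms by (simp add: powr_half_sqrt real_sqrt_mult real_sqrt_divide)
  moreover have "(D0 * L2\<^sup>2) powr (1/7) * (D0 / \<epsilon>) powr (2/7) = D0 powr (3/7) * (L2 / \<epsilon>) powr (2/7)"
  proof -
    have "(L2\<^sup>2) powr (1/7) = L2 powr (2/7)"
      using pos powr_powr[of L2 2 "1/7"] by simp
    moreover have "D0 powr (1/7) * D0 powr (2/7) = D0 powr (3/7)"
      by (simp flip: powr_add)
    ultimately show ?thesis
      using pos assms by (simp add: powr_mult powr_divide)
  qed
  \<comment> \<open>These are the cross terms of the product on the right.\<close>
  moreover have "0 \<le> sqrt D0 * (L2 / \<epsilon>) powr (2/7)" "0 \<le> D0 powr (3/7) * (\<delta> / \<epsilon>) powr (1/2)"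
    using pos by auto
  ultimately show ?thesis by (simp add: growth_def algebra_simps)
qed

end

section \<open>Runs of the algorithm\<close>

text \<open>The gain of \<open>growth_increment\<close> for \<open>K = max 1 (4 / c1)\<close> and
  \<open>k = 2 * c2\<close>, with the current growth replaced by its lower bound 1/16.\<close>

definition growth_gain :: "real \<Rightarrow> real \<Rightarrow> real" where
  "growth_gain c1 c2 = min (1 / 16) (1 / (max 1 (4 / c1) * sqrt (2 * c2))) / 7"

text \<open>Per unit of target growth \<open>g\<close>, the first summand counts steps that raise
  the growth function, the second those that lower the potential by
  \<open>3/32 * c1 ^ 3 * D0 / g\<close>.\<close>

definition iteration_factor :: "real \<Rightarrow> real \<Rightarrow> real" where
  "iteration_factor c1 c2 = 1 / growth_gain c1 c2 + 32 / (3 * c1 ^ 3)"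

lemma growth_gain_pos: "0 < c1 \<Longrightarrow> c1 \<le> c2 \<Longrightarrow> 0 < growth_gain c1 c2"
  by (simp add: growth_gain_def)

locale aine_convex_run = aine_run +
  fixes f :: "real vec \<Rightarrow> real" and Hf :: "real vec \<Rightarrow> real mat" and xstar :: "real vec"
  assumes convex: "convex_fun d f"
    and minimizer: "is_arg_min f (\<lambda>x. x \<in> carrier_vec d) xstar"
    and smooth: "twice_cont_differentiable d f gf Hf"
    and lipschitz: "lipschitz_hessian d L2 Hf"
    and estimator: "hessian_estimator d \<delta> Hf H"
    and x0: "x0 \<in> carrier_vec d"
    and D0: "D0 = 1/2 * (vec_norm (x0 - xstar))\<^sup>2"
    and c: "0 < c1" "c1 \<le> c2"
    and \<delta>: "0 \<le> \<delta>" and L2: "0 < L2"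
begin

lemma xstar_carrier: "xstar \<in> carrier_vec d"
  and f_ge_min: "w \<in> carrier_vec d \<Longrightarrow> f xstar \<le> f w"
  using minimizer by (auto simp: is_arg_min_linorder)

lemma gradient: "has_gradient d f gf"
  using smooth by (simp add: twice_cont_differentiable_def)

lemma gf_carrier: "w \<in> carrier_vec d \<Longrightarrow> gf w \<in> carrier_vec d"
  using gradient by (simp add: has_gradient_def)

lemmas subgradient = gradient_inequality[OF convex gradient]

text \<open>With \<open>lam 0 = 0\<close> the Monteiro-Svaiter condition makes the gradient at
  \<open>y 0\<close> vanish, and convexity does the rest.\<close>

lemma y0_minimizer:
  assumes "lam 0 = 0"
  shows "y 0 \<in> carrier_vec d" "f (y 0) \<le> f xstar"
proof -
  show y: "y 0 \<in> carrier_vec d"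
    using init_oracle by (auto simp: cubic_newton_oracle_def is_arg_min_linorder)
  have z: "z 0 \<in> carrier_vec d" using x0 init by simp
  have g: "gf (y 0) \<in> carrier_vec d" using y by (rule gf_carrier)
  have "vec_norm (gf (y 0) + 0 \<cdot>\<^sub>v (y 0 - z 0)) \<le> 0"
    using cubic_newton_oracle_Monteiro_Svaiter[OF smooth lipschitz estimator _ z init_oracle] L2 assms by simp
  also have "gf (y 0) + 0 \<cdot>\<^sub>v (y 0 - z 0) = gf (y 0)" using g y z by (intro eq_vecI) auto
  finally have "(xstar - y 0) \<bullet> gf (y 0) = 0"
    using y g xstar_carrier by (intro scalar_prod_eq_0_if_vec_norm_le_0) auto
  moreover have "gf (y 0) \<bullet> (xstar - y 0) = (xstar - y 0) \<bullet> gf (y 0)"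
    using y g xstar_carrier by (intro scalar_prod_commute) auto
  ultimately show "f (y 0) \<le> f xstar" using subgradient[OF xstar_carrier y] by simp
qed

definition potential :: "nat \<Rightarrow> real" where
  "potential t = A t * (f (x t) - f xstar) + (vec_norm (v t - xstar))\<^sup>2 / 2"

definition rad :: "nat \<Rightarrow> real" where
  "rad t = vec_norm (y t - z t)"

lemma potential_0: "potential 0 = D0"
  by (simp add: potential_def init D0)

section \<open>Runs that enter the loop\<close>

context
  assumes lam0: "lam 0 \<noteq> 0"
begin

lemma newton:
  assumes "t < T"
  shows "cubic_newton_oracle d gf H \<delta> L2 (z t) (y t) (lam t)"
  using init_oracle loop_oracle[OF lam0] assms by (cases t) auto

lemma y_carrier: "t < T \<Longrightarrow> y t \<in> carrier_vec d"
  using newton by (auto simp: cubic_newton_oracle_def is_arg_min_linorder)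

lemma lam_eq: "t < T \<Longrightarrow> lam t = 2 * \<delta> + L2 * rad t"
  using newton by (auto simp: cubic_newton_oracle_def rad_def)

lemma rad_nonneg: "0 \<le> rad t"
  by (simp add: rad_def vec_norm_nonneg)

lemma lam_nonneg: "t < T \<Longrightarrow> 0 \<le> lam t"
  using \<delta> L2 rad_nonneg by (simp add: lam_eq)

lemma x_v_carrier: "t \<le> T \<Longrightarrow> x t \<in> carrier_vec d \<and> v t \<in> carrier_vec d"
proof (induction t)
  case 0
  then show ?case using x0 init by simp
next
  case (Suc t)
  then show ?case
    using update[OF lam0, of t] y_carrier[of t] gf_carrier[of "y t"] by simp
qed

lemma z_carrier: "t < T \<Longrightarrow> z t \<in> carrier_vec d"
  using extrapolate[OF lam0] x_v_carrier[of t] by simp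

lemma potential_nonneg: "t \<le> T \<Longrightarrow> 0 \<le> A t \<Longrightarrow> 0 \<le> potential t"
  using x_v_carrier[of t] f_ge_min[of "x t"] by (simp add: potential_def)

context
  fixes t
  assumes t: "t < T" and lam'_pos: "0 < lam' t" and A_nonneg: "0 \<le> A t"
begin

text \<open>The new \<open>a'\<close> is the positive root of
  \<open>lam' * a\<^sup>2 = a + A\<close>; dropping the summand \<open>a\<close> gives the
  square-root bound.\<close>

lemma a'_props:
  shows a'_ge: "sqrt (A t / lam' t) \<le> a' (Suc t)"
    and a'_pos: "0 < a' (Suc t)"
    and a'_eq: "lam' t * (a' (Suc t))\<^sup>2 = A' (Suc t)"
proof -
  define q where "q = sqrt (1 + 4 * lam' t * A t)"
  have q2: "q\<^sup>2 = 1 + 4 * lam' t * A t" and q: "0 \<le> q"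
    using lam'_pos A_nonneg by (auto simp: q_def)
  have a': "a' (Suc t) = (1 + q) / (2 * lam' t)" and A': "A' (Suc t) = A t + a' (Suc t)"
    using extrapolate[OF lam0 t] by (auto simp: q_def)
  show "0 < a' (Suc t)" using a' q lam'_pos by simp
  show eq: "lam' t * (a' (Suc t))\<^sup>2 = A' (Suc t)"
  proof -
    have "(1 + q)\<^sup>2 = 4 * lam' t * A t + 2 * (1 + q)" by (simp add: power2_sum q2)
    then have "lam' t * ((1 + q) / (2 * lam' t))\<^sup>2 = A t + (1 + q) / (2 * lam' t)"
      using lam'_pos by (simp add: power_divide) (simp add: field_simps power2_eq_square)
    then show ?thesis by (simp add: a' A')
  qed
  have "A t \<le> lam' t * (a' (Suc t))\<^sup>2" using eq A' \<open>0 < a' (Suc t)\<close> by simp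
  then have "A t / lam' t \<le> (a' (Suc t))\<^sup>2" using lam'_pos by (simp add: field_simps)
  then show "sqrt (A t / lam' t) \<le> a' (Suc t)"
    using \<open>0 < a' (Suc t)\<close> by (intro real_le_lsqrt) auto
qed

lemma A'_eq: "A' (Suc t) = A t + a' (Suc t)"
  using extrapolate[OF lam0 t] by simp

lemma A'_pos: "0 < A' (Suc t)"
  using A'_eq a'_pos A_nonneg by simp

lemma \<beta>_props:
  shows \<beta>_pos: "0 < \<beta> t" and \<beta>_le_1: "\<beta> t \<le> 1" and \<beta>_lam_le: "\<beta> t * lam t \<le> lam' t"
    and \<beta>_ge: "\<And>K. 1 \<le> K \<Longrightarrow> lam t \<le> K * lam' t \<Longrightarrow> 1 / K \<le> \<beta> t"
    and \<beta>_damped: "lam' t < lam t \<Longrightarrow> \<beta> t * lam t = lam' t"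
proof -
  have \<beta>: "\<beta> t = (if lam t = 0 then 1 else min 1 (lam' t / lam t))"
    using damp[OF lam0 t] by simp
  have lam: "0 \<le> lam t" using t by (rule lam_nonneg)
  show "0 < \<beta> t" "\<beta> t \<le> 1" "\<beta> t * lam t \<le> lam' t" "lam' t < lam t \<Longrightarrow> \<beta> t * lam t = lam' t"
    using \<beta> lam lam'_pos by (auto simp: min_def field_simps)
  show "1 / K \<le> \<beta> t" if "1 \<le> K" "lam t \<le> K * lam' t" for K
    using \<beta> lam lam'_pos that by (auto simp: min_def field_simps)
qed

lemma A_Suc: "A (Suc t) = A t + \<beta> t * a' (Suc t)"
  using damp[OF lam0 t] by simp

lemma A_less: "A t < A (Suc t)"
  using A_Suc \<beta>_pos a'_pos by simp

text \<open>The new \<open>x\<close> is a convex combination of \<open>x t\<close> and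
  \<open>y t\<close>. Convexity contributes the share \<open>(1 - \<beta> t) * A t\<close> of the
  old gap, and \<open>estimate_sequence_step\<close> the share
  \<open>\<beta> t * A t\<close>.\<close>

lemma potential_decrease:
  "potential (Suc t) \<le> potential t - 3/8 * (\<beta> t * A' (Suc t) * lam t * (rad t)\<^sup>2)"
proof -
  have car: "x t \<in> carrier_vec d" "v t \<in> carrier_vec d" "y t \<in> carrier_vec d" "gf (y t) \<in> carrier_vec d"
    using x_v_carrier[of t] t y_carrier[of t] gf_carrier[of "y t"] by auto
  define A1 where "A1 = A (Suc t)"
  have A1: "0 < A1" using A_less A_nonneg by (simp add: A1_def)
  have A1_eq: "A1 = (1 - \<beta> t) * A t + \<beta> t * A' (Suc t)"
    by (simp add: A1_def A_Suc A'_eq algebra_simps)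
  have "x (Suc t) = (1 / A1) \<cdot>\<^sub>v (((1 - \<beta> t) * A t) \<cdot>\<^sub>v x t + (\<beta> t * A' (Suc t)) \<cdot>\<^sub>v y t)"
    using update[OF lam0 t] by (simp add: A1_def)
  define u where "u = \<beta> t * A' (Suc t) / A1"
  have u1: "1 - u = (1 - \<beta> t) * A t / A1"
    using A1 by (simp add: u_def A1_eq field_simps)
  have u: "0 \<le> u" "u \<le> 1"
  proof -
    show "0 \<le> u" using \<beta>_pos A'_pos A1 by (simp add: u_def)
    have "0 \<le> 1 - u" unfolding u1 using \<beta>_le_1 A_nonneg A1 by simp
    then show "u \<le> 1" by simp
  qed
  have "x (Suc t) = (1 - u) \<cdot>\<^sub>v x t + u \<cdot>\<^sub>v y t"
    unfolding u1 using car \<open>x (Suc t) = _\<close> by (intro eq_vecI)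
      (auto simp: u_def algebra_simps add_divide_distrib diff_divide_distrib)
  then have "f (x (Suc t)) \<le> (1 - u) * f (x t) + u * f (y t)"
    using convex car u by (simp add: convex_fun_def)
  then have "A1 * f (x (Suc t)) \<le> A1 * ((1 - u) * f (x t) + u * f (y t))"
    using A1 by (intro mult_left_mono) auto
  also have "\<dots> = (1 - \<beta> t) * A t * f (x t) + \<beta> t * A' (Suc t) * f (y t)"
    unfolding u1 using A1 by (simp add: u_def field_simps)
  finally have fx: "A1 * (f (x (Suc t)) - f xstar)
      \<le> (1 - \<beta> t) * A t * (f (x t) - f xstar) + \<beta> t * A' (Suc t) * (f (y t) - f xstar)"
    by (simp add: A1_eq algebra_simps)
  have v: "v (Suc t) = v t - (\<beta> t * a' (Suc t)) \<cdot>\<^sub>v gf (y t)"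
    using update[OF lam0 t] damp[OF lam0 t] by simp
  have z: "z t = (1 / A' (Suc t)) \<cdot>\<^sub>v (A t \<cdot>\<^sub>v x t + a' (Suc t) \<cdot>\<^sub>v v t)"
    using extrapolate[OF lam0 t] by simp
  have MS: "vec_norm (gf (y t) + lam t \<cdot>\<^sub>v (y t - z t)) \<le> lam t / 2 * vec_norm (y t - z t)"
    using cubic_newton_oracle_Monteiro_Svaiter[OF smooth lipschitz estimator _ z_carrier[OF t] newton[OF t]]
      L2 by simp
  have "(vec_norm (v (Suc t) - xstar))\<^sup>2 / 2 + \<beta> t * A' (Suc t) * (f (y t) - f xstar)
    \<le> (vec_norm (v t - xstar))\<^sup>2 / 2 + \<beta> t * A t * (f (x t) - f xstar)
      - 3/8 * (\<beta> t * A' (Suc t) * lam t * (vec_norm (y t - z t))\<^sup>2)"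
    unfolding v
    using car xstar_carrier z A'_eq A'_pos A_nonneg a'_pos a'_eq lam'_pos \<beta>_pos \<beta>_lam_le
      lam_nonneg[OF t] MS subgradient[of "x t" "y t"] subgradient[of xstar "y t"]
    by (intro estimate_sequence_step) auto
  then show ?thesis
    using fx unfolding potential_def rad_def A1_def[symmetric] by (simp add: algebra_simps)
qed

lemma potential_le: "potential (Suc t) \<le> potential t"
proof -
  have "0 \<le> \<beta> t * A' (Suc t) * lam t * (rad t)\<^sup>2"
    using \<beta>_pos A'_pos lam_nonneg[OF t] by simp
  then show ?thesis using potential_decrease by linarith
qed

end

text \<open>At iteration 0 the guess is exact and \<open>A 0 = 0\<close>, so the step is undamped
  and \<open>A 1 = 1 / lam 0\<close>. The potential decrease gives
  \<open>3/8 * (rad 0)\<^sup>2 \<le> D0\<close>, hence \<open>rad 0 \<le> 2 * sqrt D0\<close>, which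
  bounds \<open>lam 0\<close> from above.\<close>

lemma A_1:
  assumes "1 \<le> T"
  shows "0 < A 1" "potential 1 \<le> D0" "1 \<le> A 1 * (2 * \<delta> + 2 * L2 * sqrt D0)"
proof -
  have T: "0 < T" using assms by simp
  have D0_nonneg: "0 \<le> D0" by (simp add: D0)
  have lam': "lam' 0 = lam 0" using guess_first[OF lam0 T] .
  have pos: "0 < lam' 0" using lam0 lam' lam_nonneg[OF T] by simp
  have A0: "0 \<le> A 0" by (simp add: init)
  have \<beta>: "\<beta> 0 = 1" using damp[OF lam0 T] lam' lam0 by simp
  show "0 < A 1" using A_less[OF T pos A0] init by simp
  show "potential 1 \<le> D0" using potential_le[OF T pos A0] by (simp add: potential_0)
  have a': "a' 1 = 1 / lam 0" using extrapolate[OF lam0 T] lam' init by simp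
  then have A': "A' 1 * lam 0 = 1" using A'_eq[OF T] lam0 init pos by simp
  have A1: "A 1 * lam 0 = 1" using A_Suc[OF T] a' \<beta> init lam0 pos by simp
  have "3/8 * (\<beta> 0 * A' 1 * lam 0 * (rad 0)\<^sup>2) \<le> D0"
    using potential_decrease[OF T pos A0] potential_nonneg[of 1] assms \<open>0 < A 1\<close> by (simp add: potential_0)
  then have "3/8 * (rad 0)\<^sup>2 \<le> D0" using A' \<beta> by simp
  then have "(rad 0)\<^sup>2 \<le> (2 * sqrt D0)\<^sup>2"
    using D0_nonneg by (simp add: power_mult_distrib)
  then have "rad 0 \<le> 2 * sqrt D0" using D0_nonneg by (intro power2_le_imp_le[of "rad 0"]) auto
  then have "L2 * rad 0 \<le> L2 * (2 * sqrt D0)" using L2 by (intro mult_left_mono) auto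
  then have "lam 0 \<le> 2 * \<delta> + 2 * L2 * sqrt D0" using lam_eq[OF T] by simp
  then have "A 1 * lam 0 \<le> A 1 * (2 * \<delta> + 2 * L2 * sqrt D0)"
    using \<open>0 < A 1\<close> by (intro mult_left_mono) auto
  then show "1 \<le> A 1 * (2 * \<delta> + 2 * L2 * sqrt D0)" using A1 by simp
qed

text \<open>Iteration 0 reuses the call of the initialization, so the count is still 1 at
  \<open>t = 1\<close>.\<close>

lemma calls_eq: "1 \<le> t \<Longrightarrow> t \<le> T \<Longrightarrow> calls t = t"
proof (induction t rule: nat_induct_at_least)
  case base
  then show ?case using count[OF lam0, of 0] init_calls by simp
next
  case (Suc t)
  then show ?case using count[OF lam0, of t] by simp
qed

section \<open>Iteration count for a start away from \<open>xstar\<close>\<close>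

context
  assumes D0_pos: "0 < D0"
begin

abbreviation "scale \<equiv> guess_scale D0 \<delta> L2"
abbreviation "grw \<equiv> growth D0 \<delta> L2"

lemma guess_pos: "0 < B \<Longrightarrow> c1 * scale B \<le> l \<Longrightarrow> 0 < l"
  using guess_scale_pos[OF D0_pos \<delta> L2, of B] c by (meson less_le_trans mult_pos_pos)

text \<open>The induction starts at 1, where the guess is always fresh. Afterwards a failed doubling
  test supplies \<open>A t \<le> 2 * A (s t)\<close>, and positivity of the previous guess supplies
  the monotonicity of \<open>A\<close>.\<close>

lemma guess_invariant:
  assumes "1 \<le> t" "t < T"
  shows "0 < A t \<and> 0 < A (s t) \<and> A (s t) \<le> A t \<and> A t \<le> 2 * A (s t) \<and> lam' (s t) = lam' t \<and>
    c1 * scale (A (s t)) \<le> lam' t \<and> lam' t \<le> c2 * scale (A (s t))"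
  using assms
proof (induction t rule: nat_induct_at_least)
  case base
  then show ?case using guess_fresh[OF lam0, of 1] A_1(1) by auto
next
  case (Suc t)
  then have t: "t < T" and IH: "0 < A t" "0 < A (s t)" "A (s t) \<le> A t" "A t \<le> 2 * A (s t)"
    "lam' (s t) = lam' t" "c1 * scale (A (s t)) \<le> lam' t" "lam' t \<le> c2 * scale (A (s t))"
    by auto
  have pos: "0 < lam' t" using IH guess_pos by blast
  have less: "A t < A (Suc t)" using A_less[OF t pos] IH by simp
  show ?case
  proof (cases "Suc t = 1 \<or> A (Suc t) > 2 * A (s (Suc t - 1))")
    case True
    then show ?thesis using guess_fresh[OF lam0 _ Suc.prems True] less IH by simp
  next
    case False
    then show ?thesis using guess_stored[OF lam0 _ Suc.prems False] less IH by simp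
  qed
qed

text \<open>The lower constant survives because the scale is antitone; the upper one doubles by
  \<open>guess_scale_le_double\<close>.\<close>

lemma guess_bounds:
  assumes "1 \<le> t" "t < T"
  shows "0 < A t" "0 < lam' t" "c1 * scale (A t) \<le> lam' t" "lam' t \<le> 2 * c2 * scale (A t)"
proof -
  note inv = guess_invariant[OF assms]
  show "0 < A t" using inv by simp
  show "0 < lam' t" using inv guess_pos by blast
  have "scale (A t) \<le> scale (A (s t))" using inv by (intro guess_scale_antimono D0_pos \<delta> L2) auto
  then have "c1 * scale (A t) \<le> c1 * scale (A (s t))" using c by (intro mult_left_mono) auto
  then show "c1 * scale (A t) \<le> lam' t" using inv by linarith
  have "scale (A (s t)) \<le> 2 * scale (A t)" using inv by (intro guess_scale_le_double D0_pos \<delta> L2) auto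
  then have "c2 * scale (A (s t)) \<le> c2 * (2 * scale (A t))" using c by (intro mult_left_mono) auto
  then show "lam' t \<le> 2 * c2 * scale (A t)" using inv by linarith
qed

lemma A_mono:
  assumes "1 \<le> t" "t \<le> u" "u \<le> T"
  shows "A t \<le> A u"
  using assms(2,1,3)
proof (induction u rule: dec_induct)
  case (step n)
  then show ?case using A_less[of n] guess_bounds[of n] by simp
qed simp

lemma growth_A_ge:
  assumes "1 \<le> t" "t \<le> T"
  shows "1 / 16 \<le> grw (A t)"
proof -
  have "1 / 16 \<le> grw (A 1)" using A_1 assms by (intro growth_ge_const D0_pos \<delta> L2) auto
  also have "\<dots> \<le> grw (A t)"
    using A_1 assms A_mono[of 1 t] by (intro growth_mono D0_pos \<delta> L2) auto
  finally show ?thesis .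
qed

text \<open>A step whose \<open>\<lambda>\<close> is at most a constant times the guess is nearly undamped and increases the
  growth function; otherwise \<open>\<lambda>\<close> exceeds \<open>4\<delta>\<close>, so that the step is long and the potential drops.\<close>

lemma step_dichotomy:
  assumes "1 \<le> t" "t < T"
  shows "grw (A t) + growth_gain c1 c2 \<le> grw (A (Suc t)) \<or>
    potential (Suc t) \<le> potential t - 3/32 * c1 ^ 3 * D0 / grw (A t)"
proof -
  note b = guess_bounds[OF assms]
  have A0: "0 \<le> A t" using b by simp
  note step = a'_ge[OF assms(2) b(2) A0] \<beta>_ge[OF assms(2) b(2) A0] \<beta>_damped[OF assms(2) b(2) A0]
    potential_decrease[OF assms(2) b(2) A0] A_Suc[OF assms(2) b(2) A0]
    A'_eq[OF assms(2) b(2) A0] a'_pos[OF assms(2) b(2) A0]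
  \<comment> \<open>The value \<open>4 / c1\<close> makes \<open>K * lam' t\<close> at least
    \<open>4 * \<delta>\<close>; the maximum with 1 ensures that exceeding \<open>K * lam' t\<close>
    means being damped.\<close>
  define K where "K = max 1 (4 / c1)"
  have K: "1 \<le> K" "4 / c1 \<le> K" by (auto simp: K_def)
  show ?thesis
  proof (cases "lam t \<le> K * lam' t")
    case True
    have "1 / K * sqrt (A t / lam' t) \<le> \<beta> t * a' (Suc t)"
      using step(1) step(2)[OF K(1) True] \<beta>_pos[OF assms(2) b(2) A0] b(1,2)
      by (intro mult_mono) auto
    then have a: "sqrt (A t / lam' t) / K \<le> \<beta> t * a' (Suc t)" by simp
    have "growth_gain c1 c2 \<le> min (grw (A t)) (1 / (K * sqrt (2 * c2))) / 7"
      unfolding growth_gain_def K_def using growth_A_ge[of t] assms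
      by (intro divide_right_mono[OF min.mono]) auto
    moreover have "grw (A t) + min (grw (A t)) (1 / (K * sqrt (2 * c2))) / 7 \<le> grw (A (Suc t))"
      using growth_increment[OF D0_pos \<delta> L2 b(1) _ _ b(2,4) a] K c step(5) by simp
    ultimately show ?thesis by linarith
  next
    case False
    have "4 * \<delta> \<le> 4 * scale (A t)" by (simp add: guess_scale_ge)
    also have "\<dots> \<le> 4 / c1 * lam' t" using b(3) c by (simp add: field_simps)
    also have "\<dots> \<le> K * lam' t" using K b(2) by (intro mult_right_mono) auto
    finally have "4 * \<delta> \<le> lam t" using False by simp
    \<comment> \<open>The part \<open>2 * \<delta>\<close> of \<open>lam t\<close> is at most half
      of it.\<close>
    then have "lam t \<le> 2 * (L2 * rad t)" using lam_eq[OF assms(2)] by simp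
    moreover have damped: "lam' t < lam t"
    proof -
      have "lam' t \<le> K * lam' t" using K b(2) by simp
      with False show ?thesis by linarith
    qed
    ultimately have "lam' t \<le> 2 * L2 * rad t" by simp
    then have "(lam' t)\<^sup>2 \<le> (2 * L2 * rad t)\<^sup>2" using b(2) by (intro power_mono) auto
    then have r: "(lam' t)\<^sup>2 / (4 * L2\<^sup>2) \<le> (rad t)\<^sup>2"
      using L2 by (simp add: power_mult_distrib field_simps)
    have g: "0 < grw (A t)" using growth_pos[OF D0_pos \<delta> L2 b(1)] .
    have "D0 * L2\<^sup>2 / grw (A t) \<le> A t * scale (A t) ^ 3"
      using growth_mult_guess_scale_cube_ge[OF D0_pos \<delta> L2 b(1)] g by (simp add: field_simps)
    then have "c1 ^ 3 * (D0 * L2\<^sup>2 / grw (A t)) \<le> c1 ^ 3 * (A t * scale (A t) ^ 3)"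
      using c by (intro mult_left_mono) auto
    also have "\<dots> = A t * (c1 * scale (A t)) ^ 3" by (simp add: power_mult_distrib)
    also have "\<dots> \<le> A t * lam' t ^ 3"
      using b c guess_scale_pos[OF D0_pos \<delta> L2 b(1)] by (intro mult_left_mono power_mono) auto
    \<comment> \<open>The 1/4 comes from squaring \<open>rad t \<ge> lam' t / (2 * L2)\<close>; with
      the 3/8 of the potential decrease it makes 3/32.\<close>
    finally have "c1 ^ 3 * D0 / grw (A t) / 4 \<le> A t * lam' t * ((lam' t)\<^sup>2 / (4 * L2\<^sup>2))"
      using L2 g by (simp add: field_simps power2_eq_square power3_eq_cube)
    also have "\<dots> \<le> A t * lam' t * (rad t)\<^sup>2" using r b by (intro mult_left_mono) auto
    also have "\<dots> \<le> A' (Suc t) * lam' t * (rad t)\<^sup>2"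
      using step(6,7) b by (intro mult_right_mono) auto
    also have "\<dots> = \<beta> t * A' (Suc t) * lam t * (rad t)\<^sup>2"
      using step(3)[OF damped] by (simp add: algebra_simps flip: mult.assoc)
    finally show ?thesis using step(4) by simp
  qed
qed

text \<open>Below the target the growth function is at most \<open>g\<close>, so either case of the
  dichotomy raises \<open>\<Phi>\<close> by at least 1. Over the iterations after the first,
  \<open>\<Phi>\<close> can rise by no more than \<open>p * g + q * D0\<close>.\<close>

lemma target_reached:
  assumes \<epsilon>: "0 < \<epsilon>" and T: "1 \<le> T"
    and many: "iteration_factor c1 c2 * grw (D0 / \<epsilon>) < real T - 1"
  shows "D0 / \<epsilon> \<le> A T"
proof (rule ccontr)
  assume below: "\<not> D0 / \<epsilon> \<le> A T"
  define g where "g = grw (D0 / \<epsilon>)"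
  \<comment> \<open>The weights are the reciprocals of the growth gain and of the potential drop at
    growth \<open>g\<close>.\<close>
  define p q where "p = 1 / growth_gain c1 c2" and "q = g * 32 / (3 * c1 ^ 3 * D0)"
  have g: "0 < g" using growth_pos[OF D0_pos \<delta> L2] D0_pos \<epsilon> by (simp add: g_def)
  have p: "0 < p" using growth_gain_pos[OF c] by (simp add: p_def)
  have q: "0 < q" using g c D0_pos by (simp add: q_def)
  have le_g: "grw (A t) \<le> g" if "1 \<le> t" "t \<le> T" for t
    unfolding g_def using A_mono[of t T] A_mono[of 1 t] A_1(1)[OF T] below that
    by (intro growth_mono D0_pos \<delta> L2) auto
  define \<Phi> where "\<Phi> t = p * grw (A t) - q * potential t" for t
  have step: "\<Phi> t + 1 \<le> \<Phi> (Suc t)" if t: "1 \<le> t" "t < T" for t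
  proof -
    note b = guess_bounds[OF t]
    have up: "grw (A t) \<le> grw (A (Suc t))"
      using A_mono[of t "Suc t"] b t by (intro growth_mono D0_pos \<delta> L2) auto
    have down: "potential (Suc t) \<le> potential t" using potential_le[OF t(2) b(2)] b by simp
    from step_dichotomy[OF t] show ?thesis
    proof
      assume "grw (A t) + growth_gain c1 c2 \<le> grw (A (Suc t))"
      then have "p * (grw (A t) + growth_gain c1 c2) \<le> p * grw (A (Suc t))" using p by simp
      moreover have "p * growth_gain c1 c2 = 1" using growth_gain_pos[OF c] by (simp add: p_def)
      moreover have "q * potential (Suc t) \<le> q * potential t" using down q by simp
      ultimately show ?thesis unfolding \<Phi>_def distrib_left by linarith
    next
      assume *: "potential (Suc t) \<le> potential t - 3/32 * c1 ^ 3 * D0 / grw (A t)"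
      have "3/32 * c1 ^ 3 * D0 / g \<le> 3/32 * c1 ^ 3 * D0 / grw (A t)"
        using le_g[of t] growth_pos[OF D0_pos \<delta> L2 b(1)] t g c D0_pos by (intro divide_left_mono) auto
      then have "q * potential (Suc t) \<le> q * (potential t - 3/32 * c1 ^ 3 * D0 / g)"
        using * q by (intro mult_left_mono) auto
      moreover have "q * (3/32 * c1 ^ 3 * D0 / g) = 1" using g c D0_pos by (simp add: q_def)
      moreover have "p * grw (A t) \<le> p * grw (A (Suc t))" using up p by simp
      ultimately show ?thesis unfolding \<Phi>_def right_diff_distrib by linarith
    qed
  qed
  have "\<Phi> 1 + (real t - 1) \<le> \<Phi> t" if "1 \<le> t" "t \<le> T" for t
    using that
  proof (induction t rule: nat_induct_at_least)
    case (Suc t)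
    then show ?case using step[of t] by simp
  qed simp
  then have "real T - 1 \<le> \<Phi> T - \<Phi> 1" using T by (simp add: algebra_simps)
  also have "\<dots> \<le> p * g + q * D0"
  proof -
    have "p * grw (A T) \<le> p * g" using le_g[of T] T p by simp
    moreover have "0 \<le> p * grw (A 1)" using p growth_pos[OF D0_pos \<delta> L2 A_1(1)[OF T]] by simp
    moreover have "q * potential 1 \<le> q * D0" using A_1(2)[OF T] q by simp
    moreover have "0 \<le> q * potential T"
      using q potential_nonneg[of T] A_mono[of 1 T] A_1(1)[OF T] T by simp
    ultimately show ?thesis by (simp add: \<Phi>_def)
  qed
  also have "\<dots> = iteration_factor c1 c2 * g"
    using D0_pos by (simp add: iteration_factor_def p_def q_def algebra_simps)
  finally show False using many by (simp add: g_def)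
qed

lemma potential_le_D0:
  assumes "1 \<le> t" "t \<le> T"
  shows "potential t \<le> D0"
  using assms
proof (induction t rule: nat_induct_at_least)
  case base
  then show ?case using A_1(2) by simp
next
  case (Suc t)
  then show ?case using potential_le[of t] guess_bounds[of t] by simp
qed

lemma final_accuracy:
  assumes \<epsilon>: "0 < \<epsilon>" and T: "1 \<le> T"
    and many: "iteration_factor c1 c2 * grw (D0 / \<epsilon>) < real T - 1"
  shows "f (x T) - f xstar \<le> \<epsilon>"
proof -
  have "0 \<le> f (x T) - f xstar" using f_ge_min[of "x T"] x_v_carrier[of T] by simp
  then have "D0 / \<epsilon> * (f (x T) - f xstar) \<le> A T * (f (x T) - f xstar)"
    using target_reached[OF assms] by (intro mult_right_mono) auto
  also have "\<dots> \<le> potential T" by (simp add: potential_def)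
  also have "\<dots> \<le> D0" using potential_le_D0 T by simp
  finally have "D0 / \<epsilon> * (f (x T) - f xstar) \<le> D0 / \<epsilon> * \<epsilon>" using \<epsilon> by simp
  then show ?thesis
    using D0_pos \<epsilon> by (simp only: mult_le_cancel_left_pos[OF divide_pos_pos[OF D0_pos \<epsilon>]])
qed

end

text \<open>Covers \<open>D0 = 0\<close>: after one iteration the potential is nonpositive while
  \<open>A 1\<close> is positive.\<close>

lemma one_step_accuracy:
  assumes "D0 \<le> 0" "T = 1"
  shows "f (x T) \<le> f xstar"
proof -
  have "A 1 * (f (x 1) - f xstar) \<le> potential 1" by (simp add: potential_def)
  also have "\<dots> \<le> 0" using A_1(2) assms by simp
  finally show ?thesis using A_1(1) assms by (simp add: mult_le_0_iff)
qed

end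

end

theorem corollary3p1:
  fixes D0 c1 c2 :: real
  assumes "0 < c1" and "c1 \<le> c2"
  shows "\<exists>C > 0. \<forall>\<delta> L2 \<epsilon> :: real. 0 \<le> \<delta> \<longrightarrow> 0 < L2 \<longrightarrow> 0 < \<epsilon> \<longrightarrow>
    (\<exists>T. \<forall>(d :: nat) f gf Hf xstar H x0 xhat N.
        convex_fun d f \<longrightarrow>
        is_arg_min f (\<lambda>x. x \<in> carrier_vec d) xstar \<longrightarrow>
        twice_cont_differentiable d f gf Hf \<longrightarrow>
        lipschitz_hessian d L2 Hf \<longrightarrow>
        hessian_estimator d \<delta> Hf H \<longrightarrow>
        x0 \<in> carrier_vec d \<longrightarrow>
        D0 = 1/2 * (vec_norm (x0 - xstar))\<^sup>2 \<longrightarrow>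
        aine_output d gf H \<delta> L2 D0 c1 c2 x0 T xhat N \<longrightarrow>
        xhat \<in> carrier_vec d \<and>
        f xhat - f xstar \<le> \<epsilon> \<and>
        real N \<le> C * max 1 ((\<delta> / \<epsilon>) powr (1/2) + (L2 / \<epsilon>) powr (2/7)))"
proof -
  define F where "F = iteration_factor c1 c2"
  have F: "0 < F" using growth_gain_pos[OF assms] assms by (simp add: F_def iteration_factor_def add_pos_pos)
  \<comment> \<open>The 2 pays for the two successors in \<open>T\<close>, the rest comes from
    \<open>growth_at_target\<close>. The absolute value keeps \<open>C\<close> positive for every
    real \<open>D0\<close>.\<close>
  define C where "C = 2 + F * (sqrt \<bar>D0\<bar> + D0 powr (3/7))"
  have "2 \<le> C" using F by (simp add: C_def)
  show ?thesis
  proof (intro exI[of _ C] conjI allI impI)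
    show "0 < C" using \<open>2 \<le> C\<close> by simp
    fix \<delta> L2 \<epsilon> :: real
    assume \<delta>: "0 \<le> \<delta>" and L2: "0 < L2" and \<epsilon>: "0 < \<epsilon>"
    define S where "S = (\<delta> / \<epsilon>) powr (1/2) + (L2 / \<epsilon>) powr (2/7)"
    define G where "G = growth D0 \<delta> L2 (D0 / \<epsilon>)"
    \<comment> \<open>One successor makes the rounding strict, the other accounts for iteration 0;
      together they give \<open>F * G < T - 1\<close>.\<close>
    define T where "T = (if 0 < D0 then Suc (Suc (nat \<lfloor>F * G\<rfloor>)) else 1)"
    have one: "1 \<le> C * max 1 S" using \<open>2 \<le> C\<close> mult_mono[of 1 C 1 "max 1 S"] by simp
    have T1: "1 \<le> T" by (simp add: T_def)
    have FG: "F * G < real T - 1" if "0 < D0"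
      using that by (simp add: T_def) linarith
    have T_le: "real T \<le> C * max 1 S"
    proof (cases "0 < D0")
      case True
      have "0 < G" using growth_pos[OF True \<delta> L2, of "D0 / \<epsilon>"] True \<epsilon> by (simp add: G_def)
      then have "0 \<le> F * G" using F by simp
      then have "real T \<le> 2 + F * G" using True by (simp add: T_def)
      also have "F * G \<le> F * ((sqrt D0 + D0 powr (3/7)) * S)"
        using growth_at_target[OF True \<delta> L2 \<epsilon>] F by (simp add: G_def S_def)
      also have "\<dots> \<le> F * ((sqrt D0 + D0 powr (3/7)) * max 1 S)"
        using F True by (intro mult_left_mono) auto
      also have "2 + \<dots> \<le> C * max 1 S"
        using True by (simp add: C_def algebra_simps)
      finally show ?thesis by simp
    next
      case False
      then show ?thesis using one by (simp add: T_def)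
    qed
    show "\<exists>T. \<forall>(d :: nat) f gf Hf xstar H x0 xhat N.
        convex_fun d f \<longrightarrow>
        is_arg_min f (\<lambda>x. x \<in> carrier_vec d) xstar \<longrightarrow>
        twice_cont_differentiable d f gf Hf \<longrightarrow>
        lipschitz_hessian d L2 Hf \<longrightarrow>
        hessian_estimator d \<delta> Hf H \<longrightarrow>
        x0 \<in> carrier_vec d \<longrightarrow>
        D0 = 1/2 * (vec_norm (x0 - xstar))\<^sup>2 \<longrightarrow>
        aine_output d gf H \<delta> L2 D0 c1 c2 x0 T xhat N \<longrightarrow>
        xhat \<in> carrier_vec d \<and>
        f xhat - f xstar \<le> \<epsilon> \<and>
        real N \<le> C * max 1 ((\<delta> / \<epsilon>) powr (1/2) + (L2 / \<epsilon>) powr (2/7))"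
      unfolding S_def[symmetric]
    proof (intro exI[of _ T] allI impI)
      fix d :: nat and f gf Hf xstar H x0 xhat N
      assume f: "convex_fun d f" "is_arg_min f (\<lambda>x. x \<in> carrier_vec d) xstar"
          "twice_cont_differentiable d f gf Hf" "lipschitz_hessian d L2 Hf"
          "hessian_estimator d \<delta> Hf H" "x0 \<in> carrier_vec d"
          "D0 = 1/2 * (vec_norm (x0 - xstar))\<^sup>2"
        and out: "aine_output d gf H \<delta> L2 D0 c1 c2 x0 T xhat N"
      then obtain x v z y a a' A A' lam lam' \<beta> s calls
        where run: "aine_run d gf H \<delta> L2 D0 c1 c2 x0 T x v z y a a' A A' lam lam' \<beta> s calls"
          and res: "if lam 0 = 0 then xhat = y 0 \<and> N = calls 0 else xhat = x T \<and> N = calls T"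
        unfolding aine_output_def by blast
      interpret aine_convex_run d gf H \<delta> L2 D0 c1 c2 x0 T x v z y a a' A A' lam lam' \<beta> s calls f Hf xstar
        by (intro aine_convex_run.intro aine_convex_run_axioms.intro run f assms \<delta> L2)
      show "xhat \<in> carrier_vec d \<and> f xhat - f xstar \<le> \<epsilon> \<and> real N \<le> C * max 1 S"
      proof (cases "lam 0 = 0")
        case True
        then show ?thesis using res y0_minimizer init_calls one \<epsilon> by simp
      next
        case False
        have "f (x T) - f xstar \<le> \<epsilon>"
        proof (cases "0 < D0")
          case True
          then show ?thesis
            using final_accuracy[OF False True \<epsilon> T1] FG by (simp add: F_def G_def)
        next
          case nonpos: False
          then show ?thesis using one_step_accuracy[OF False] \<epsilon> by (simp add: T_def)
        qed
        then show ?thesis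
          using res False x_v_carrier[OF False, of T] calls_eq[OF False T1] T_le by simp
      qed
    qed
  qed
qed

end
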